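(* Given a Petri net $N=(S,T,m_0)$, a set of places $V\subseteq S$ and a place $p\in S$, it is decidable whether $N$ infinitely visits $V$ with mandatory place $p$.
   Context: A Petri net is a triple $N=(S,T,m_0)$ with $S$ a finite set of places, $T$ a finite set of transitions, and $m_0$ an initial marking, where a marking is a finite multiset over $S$ ($m(q)$ is the number of tokens in place $q$). A transition is a pair of markings written $m'\Rightarrow m''$; it can fire in marking $m$ if $m(q)\ge m'(q)$ for all $q\in S$, yielding the marking $(m\setminus m')\uplus m''$ (multiset difference and union); this is written $m\Rightarrow n$. $N$ infinitely visits $V$ with mandatory place $p$ if there exist an infinite sequence of firings $m_0\Rightarrow m_1\Rightarrow m_2\Rightarrow\cdots$ and an index $i$ such that for every $j\ge i$ there is a place $p_j\in V$ with $m_j(p_j)\ge1$, and moreover $m_j(p)\ge1$. *)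

theory Defs
  imports Main "HOL-Library.Multiset" "HOL-Library.Nat_Bijection"
begin

section \<open>Petri nets\<close>

record 's petri_net =
  places :: "'s set"
  transitions :: "('s multiset \<times> 's multiset) set"
  initial :: "'s multiset"

definition petri_net :: "'s petri_net \<Rightarrow> bool" where
  "petri_net N \<longleftrightarrow>
     finite (places N) \<and> finite (transitions N) \<and>
     (\<forall>(a, b) \<in> transitions N. set_mset a \<subseteq> places N \<and> set_mset b \<subseteq> places N) \<and>
     set_mset (initial N) \<subseteq> places N"

definition fires :: "'s petri_net \<Rightarrow> 's multiset \<Rightarrow> 's multiset \<Rightarrow> bool" where
  "fires N m n \<longleftrightarrow> (\<exists>(a, b) \<in> transitions N. a \<subseteq># m \<and> n = (m - a) + b)"

definition infinitely_visits :: "'s petri_net \<Rightarrow> 's set \<Rightarrow> 's \<Rightarrow> bool" where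
  "infinitely_visits N V p \<longleftrightarrow>
     (\<exists>m :: nat \<Rightarrow> 's multiset. \<exists>i.
        m 0 = initial N \<and> (\<forall>j. fires N (m j) (m (Suc j))) \<and>
        (\<forall>j\<ge>i. (\<exists>q\<in>V. count (m j) q \<ge> 1) \<and> count (m j) p \<ge> 1))"


section \<open>Decidability\<close>

text \<open>
  Decidability is taken with respect to Kleene's partial recursive functions. A term of
  the type below is a program and \<open>rec_run\<close> is the partial function it denotes,
  with \<open>None\<close> for an undefined value.
\<close>

datatype recf =
    Zero
  | Succ
  | Proj nat
  | Comp recf "recf list"
  | PrimRec recf recf
  | Mu recf

fun rec_run :: "recf \<Rightarrow> nat list \<Rightarrow> nat option" where
  "rec_run Zero xs = Some 0"
| "rec_run Succ xs = (case xs of [x] \<Rightarrow> Some (Suc x) | _ \<Rightarrow> None)"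
| "rec_run (Proj i) xs = (if i < length xs then Some (xs ! i) else None)"
| "rec_run (Comp f gs) xs =
     Option.bind (those (map (\<lambda>g. rec_run g xs) gs)) (\<lambda>ys. rec_run f ys)"
| "rec_run (PrimRec f g) xs =
     (case xs of
        [] \<Rightarrow> None
      | x # ys \<Rightarrow>
          rec_nat (rec_run f ys) (\<lambda>k r. Option.bind r (\<lambda>v. rec_run g (k # v # ys))) x)"
| "rec_run (Mu f) xs =
     (if \<exists>y. rec_run f (y # xs) = Some 0 \<and> (\<forall>z<y. rec_run f (z # xs) \<noteq> None)
      then Some (LEAST y. rec_run f (y # xs) = Some 0)
      else None)"

definition decidable_set :: "nat set \<Rightarrow> bool" where
  "decidable_set A \<longleftrightarrow> (\<exists>c. \<forall>n. rec_run c [n] = Some (if n \<in> A then 1 else 0))"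


section \<open>Encoding of problem instances\<close>

text \<open>
  Places of input nets are named by natural numbers; the set of places is an arbitrary finite
  set of such names. A marking is coded by the increasingly sorted list of its tokens, and
  finite sets by the binary expansion \<open>set_encode\<close>, so that every instance has exactly one
  code.
\<close>

definition marking_encode :: "nat multiset \<Rightarrow> nat" where
  "marking_encode m = list_encode (sorted_list_of_multiset m)"

definition transition_encode :: "nat multiset \<times> nat multiset \<Rightarrow> nat" where
  "transition_encode t = prod_encode (marking_encode (fst t), marking_encode (snd t))"

definition net_encode :: "nat petri_net \<Rightarrow> nat" where
  "net_encode N =
     list_encode
       [set_encode (places N),
        set_encode (transition_encode ` transitions N),
        marking_encode (initial N)]"

definition instance_encode :: "nat petri_net \<Rightarrow> nat set \<Rightarrow> nat \<Rightarrow> nat" where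
  "instance_encode N V p = list_encode [net_encode N, set_encode V, p]"

lemma marking_encode_eq_iff: "marking_encode m = marking_encode m' \<longleftrightarrow> m = m'"
  unfolding marking_encode_def list_encode_eq by (metis mset_sorted_list_of_multiset)

lemma inj_transition_encode: "inj transition_encode"
  by (auto simp: inj_def transition_encode_def marking_encode_eq_iff)

lemma net_encode_eq_iff:
  assumes "petri_net N" and "petri_net N'"
  shows "net_encode N = net_encode N' \<longleftrightarrow> N = N'"
proof
  assume eq: "net_encode N = net_encode N'"
  have "places N = places N'"
    using eq assms by (auto simp: net_encode_def list_encode_eq petri_net_def set_encode_eq
        simp del: list_encode.simps)
  moreover have "transition_encode ` transitions N = transition_encode ` transitions N'"
    using eq assms by (simp add: net_encode_def list_encode_eq petri_net_def set_encode_eq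
        del: list_encode.simps)
  then have "transitions N = transitions N'"
    using inj_transition_encode by (simp add: inj_image_eq_iff)
  moreover have "initial N = initial N'"
    using eq by (simp add: net_encode_def list_encode_eq marking_encode_eq_iff
        del: list_encode.simps)
  ultimately show "N = N'" by simp
qed simp

lemma instance_encode_eq_iff:
  assumes "petri_net N" "V \<subseteq> places N" and "petri_net N'" "V' \<subseteq> places N'"
  shows "instance_encode N V p = instance_encode N' V' p' \<longleftrightarrow> N = N' \<and> V = V' \<and> p = p'"
proof -
  have "finite V" "finite V'"
    using assms by (auto simp: petri_net_def intro: finite_subset)
  then show ?thesis
    using assms by (simp add: instance_encode_def list_encode_eq net_encode_eq_iff set_encode_eq
        del: list_encode.simps)
qed

end

theory Submission
  imports Defs Complex_Main "HOL-Library.Infinite_Set"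
begin

text \<open>
  Let \<open>R\<close> be the set of markings that mark \<open>p\<close> and some place of \<open>V\<close>. By Dickson's lemma
  the net visits infinitely iff some reachable \<open>m\<close> has a nonempty firing sequence to some
  \<open>n \<ge> m\<close> inside \<open>R\<close>, which is a semidecidable property. Its complement is semidecidable as well,
  by the following certificates. Count tokens only up to a bound \<open>B\<close>, reading \<open>B\<close> as \<open>\<omega>\<close>, and
  let a place that has reached \<open>\<omega>\<close> stay there. This gives a finite graph over-approximating the net.
  An infinite run in \<open>R\<close> yields, again by Dickson, a closed walk in the graph whose total effect on
  all places is nonnegative. Such a walk is excluded if each nonempty set \<open>F\<close> of edges inside \<open>R\<close>
  is either not strongly connected or admits nonnegative weights on the places and a potential on
  the nodes whose combination never increases along \<open>F\<close> and decreases along some edge of \<open>F\<close>.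

  Conversely, the downward closure of the reachability set is determined by its
  elements truncated at a suitable \<open>B\<close>. For that \<open>B\<close> every node stands for markings that are
  covered by reachable ones with arbitrarily many tokens on the \<open>\<omega>\<close>-places. If \<open>F\<close> is strongly
  connected and has no weights, then Farkas' lemma gives a circulation that is positive on \<open>F\<close> and
  has nonnegative effect, and Euler's argument turns a multiple of it into a closed walk. Along a
  closed walk no place can become \<open>\<omega>\<close>, so it is exact on the other places and can be fired
  from a reachable marking.
\<close>

section \<open>Recursive functions and recursively enumerable predicates\<close>

text \<open>
  Functions and predicates of several variables take an environment \<open>nat \<Rightarrow> nat\<close> of which only
  finitely many entries matter; a bound variable is pushed in front of the environment.
  Demanding a program for every sufficiently large arity makes functions with different numbers of
  relevant entries composable.
\<close>

definition recursive :: "((nat \<Rightarrow> nat) \<Rightarrow> nat) \<Rightarrow> bool" where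
  "recursive f \<longleftrightarrow> (\<exists>K. \<forall>k\<ge>K. \<exists>c. \<forall>e. rec_run c (map e [0..<k]) = Some (f e))"

definition dec :: "((nat \<Rightarrow> nat) \<Rightarrow> bool) \<Rightarrow> bool" where
  "dec P \<longleftrightarrow> recursive (\<lambda>e. of_bool (P e))"

text \<open>Semidecidability as projection of a decidable predicate: closure properties become
  manipulations of the witness in entry 0 instead of constructions of programs.\<close>

definition re :: "((nat \<Rightarrow> nat) \<Rightarrow> bool) \<Rightarrow> bool" where
  "re P \<longleftrightarrow> (\<exists>Q. dec (\<lambda>e. Q (e 0) (\<lambda>i. e (Suc i))) \<and> (\<forall>e. P e \<longleftrightarrow> (\<exists>y. Q y e)))"

lemma those_map_Some: "those (map (\<lambda>x. Some (f x)) xs) = Some (map f xs)"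
  by (induction xs) auto

lemma recursive_var: "recursive (\<lambda>e. e i)"
  unfolding recursive_def
proof (intro exI[of _ "Suc i"] allI impI exI)
  fix k e assume "Suc i \<le> k"
  then show "rec_run (Proj i) (map e [0..<k]) = Some (e i)" by simp
qed

lemma recursive_Suc:
  assumes "recursive f" shows "recursive (\<lambda>e. Suc (f e))"
proof -
  obtain K where K: "\<forall>k\<ge>K. \<exists>c. \<forall>e. rec_run c (map e [0..<k]) = Some (f e)"
    using assms unfolding recursive_def by blast
  show ?thesis unfolding recursive_def
  proof (intro exI[of _ K] allI impI)
    fix k assume "K \<le> k"
    then obtain c where "\<forall>e. rec_run c (map e [0..<k]) = Some (f e)" using K by blast
    then have "\<forall>e. rec_run (Comp Succ [c]) (map e [0..<k]) = Some (Suc (f e))" by simp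
    then show "\<exists>c. \<forall>e. rec_run c (map e [0..<k]) = Some (Suc (f e))" by blast
  qed
qed

lemma recursive_const: "recursive (\<lambda>e. n)"
proof (induction n)
  case 0
  have "\<forall>e. rec_run Zero (map e [0..<k]) = Some 0" for k by simp
  then show ?case unfolding recursive_def by blast
next
  case (Suc n)
  then show ?case by (rule recursive_Suc)
qed

text \<open>A program for \<open>F\<close> at one fixed arity \<open>K\<close> reads only the
  entries below \<open>K\<close>. So only finitely many of the \<open>s i\<close> matter, and their
  arity bounds have a maximum.\<close>

lemma recursive_subst:
  assumes F: "recursive F" and s: "\<And>i. recursive (s i)"
  shows "recursive (\<lambda>e. F (\<lambda>i. s i e))"
proof -
  obtain K cF where cF: "\<And>e. rec_run cF (map e [0..<K]) = Some (F e)"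
    using F unfolding recursive_def by blast
  have "\<exists>L. \<forall>i. \<forall>k\<ge>L i. \<exists>c. \<forall>e. rec_run c (map e [0..<k]) = Some (s i e)"
    using s unfolding recursive_def by metis
  then obtain L where L: "\<And>i k. k \<ge> L i \<Longrightarrow> \<exists>c. \<forall>e. rec_run c (map e [0..<k]) = Some (s i e)"
    by blast
  show ?thesis unfolding recursive_def
  proof (intro exI[of _ "Max (L ` {..K})"] allI impI)
    fix k assume k: "Max (L ` {..K}) \<le> k"
    have "\<forall>i<K. \<exists>c. \<forall>e. rec_run c (map e [0..<k]) = Some (s i e)"
    proof (intro allI impI)
      fix i assume "i < K"
      then have "L i \<le> Max (L ` {..K})" by (intro Max_ge) auto
      then show "\<exists>c. \<forall>e. rec_run c (map e [0..<k]) = Some (s i e)" using L k le_trans by blast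
    qed
    then obtain c where c: "\<And>i e. i < K \<Longrightarrow> rec_run (c i) (map e [0..<k]) = Some (s i e)" by metis
    have "rec_run (Comp cF (map c [0..<K])) (map e [0..<k]) = Some (F (\<lambda>i. s i e))" for e
    proof -
      have "map (\<lambda>g. rec_run g (map e [0..<k])) (map c [0..<K]) = map (\<lambda>i. Some (s i e)) [0..<K]"
        by (simp add: c)
      then show ?thesis by (simp add: those_map_Some cF del: map_map)
    qed
    then show "\<exists>c. \<forall>e. rec_run c (map e [0..<k]) = Some (F (\<lambda>i. s i e))" by blast
  qed
qed

lemma recursive_app:
  assumes "recursive (\<lambda>e. F (e 0) (\<lambda>i. e (Suc i)))" "recursive n"
  shows "recursive (\<lambda>e. F (n e) e)"
proof -
  have "recursive (case_nat n (\<lambda>i e. e i) i)" for i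
    by (cases i) (auto simp: recursive_var assms)
  from recursive_subst[OF assms(1), of "case_nat n (\<lambda>i e. e i)", OF this] show ?thesis by simp
qed

lemma recursive_app2:
  assumes "recursive (\<lambda>e. F (e 0) (e 1))" "recursive m" "recursive n"
  shows "recursive (\<lambda>e. F (m e) (n e))"
proof -
  have "recursive (case_nat m (\<lambda>_. n) i)" for i
    by (cases i) (auto simp: assms)
  from recursive_subst[OF assms(1), of "case_nat m (\<lambda>_. n)", OF this] show ?thesis by simp
qed

lemma recursive_rec_nat:
  assumes "recursive f" and "recursive (\<lambda>e. g (e 0) (e 1) (\<lambda>i. e (Suc (Suc i))))"
    and "recursive n"
  shows "recursive (\<lambda>e. rec_nat (f e) (\<lambda>k r. g k r e) (n e))"
proof -
  obtain K where K: "\<forall>k\<ge>K. \<exists>c. \<forall>e. rec_run c (map e [0..<k]) = Some (f e)"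
    using assms(1) unfolding recursive_def by blast
  obtain L where L: "\<forall>k\<ge>L. \<exists>c. \<forall>e. rec_run c (map e [0..<k]) =
      Some (g (e 0) (e 1) (\<lambda>i. e (Suc (Suc i))))"
    using assms(2) unfolding recursive_def by blast
  \<comment> \<open>\<open>PrimRec\<close> recurses on its first argument, so the claim is first
    proved with entry 0 in place of \<open>n e\<close>; substituting \<open>n e\<close> comes
    last.\<close>
  have "recursive (\<lambda>e. rec_nat (f (\<lambda>i. e (Suc i))) (\<lambda>k r. g k r (\<lambda>i. e (Suc i))) (e 0))"
    unfolding recursive_def
  proof (intro exI[of _ "Suc (K + L)"] allI impI)
    fix k assume "Suc (K + L) \<le> k"
    then obtain j where j: "k = Suc j" "K \<le> j" "L \<le> Suc (Suc j)" by (cases k) auto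
    obtain c where c: "\<And>e. rec_run c (map e [0..<j]) = Some (f e)" using K j by blast
    obtain d where d: "\<And>e. rec_run d (map e [0..<Suc (Suc j)]) =
        Some (g (e 0) (e 1) (\<lambda>i. e (Suc (Suc i))))" using L j by blast
    have d': "rec_run d (x # y # map e [0..<j]) = Some (g x y e)" for x y e
      using d[of "case_nat x (case_nat y e)"] by (simp add: map_upt_Suc del: upt_Suc)
    have "rec_nat (rec_run c (map e [0..<j])) (\<lambda>k r. Option.bind r (\<lambda>v. rec_run d (k # v # map e [0..<j]))) x
        = Some (rec_nat (f e) (\<lambda>k r. g k r e) x)" for e x
      by (induction x) (auto simp: c d')
    then have "\<forall>e. rec_run (PrimRec c d) (map e [0..<k]) =
        Some (rec_nat (f (\<lambda>i. e (Suc i))) (\<lambda>k r. g k r (\<lambda>i. e (Suc i))) (e 0))"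
      by (simp add: j map_upt_Suc del: upt_Suc)
    then show "\<exists>c. \<forall>e. rec_run c (map e [0..<k]) =
        Some (rec_nat (f (\<lambda>i. e (Suc i))) (\<lambda>k r. g k r (\<lambda>i. e (Suc i))) (e 0))" by blast
  qed
  from recursive_app[OF this assms(3)] show ?thesis .
qed

section \<open>Decidable predicates, arithmetic and bounded quantifiers\<close>

lemma recursive_of_bool [simp]: "recursive (\<lambda>e. of_bool (P e)) \<longleftrightarrow> dec P"
  by (simp add: dec_def)

lemma dec_zero:
  assumes "recursive f" shows "dec (\<lambda>e. f e = 0)"
proof -
  have "recursive (\<lambda>e. rec_nat 1 (\<lambda>_ _. 0) (f e))"
    by (intro recursive_rec_nat recursive_const assms)
  moreover have "rec_nat 1 (\<lambda>_ _. 0) x = (of_bool (x = 0) :: nat)" for x by (cases x) auto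
  ultimately show ?thesis by simp
qed

lemma dec_not:
  assumes "dec P" shows "dec (\<lambda>e. \<not> P e)"
  using dec_zero[OF assms[unfolded dec_def]] by simp

lemma recursive_if:
  assumes "dec P" "recursive f" "recursive g"
  shows "recursive (\<lambda>e. if P e then f e else g e)"
proof -
  have sh: "recursive (\<lambda>e. f (\<lambda>i. e (Suc (Suc i))))"
    using assms(2) by (rule recursive_subst) (rule recursive_var)
  have "recursive (\<lambda>e. rec_nat (g e) (\<lambda>_ _. f e) (of_bool (P e)))"
    by (rule recursive_rec_nat[OF assms(3) sh]) (simp add: assms)
  moreover have "rec_nat (g e) (\<lambda>_ _. f e) (of_bool (P e)) = (if P e then f e else g e)" for e by simp
  ultimately show ?thesis by simp
qed

lemma dec_conj:
  assumes "dec P" "dec Q" shows "dec (\<lambda>e. P e \<and> Q e)"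
proof -
  have "recursive (\<lambda>e. if P e then of_bool (Q e) else 0)"
    by (intro recursive_if recursive_const assms) (simp add: assms)
  moreover have "(if P e then of_bool (Q e) else 0) = (of_bool (P e \<and> Q e) :: nat)" for e by simp
  ultimately show ?thesis by simp
qed

lemma dec_disj:
  assumes "dec P" "dec Q" shows "dec (\<lambda>e. P e \<or> Q e)"
  using dec_not[OF dec_conj[OF dec_not[OF assms(1)] dec_not[OF assms(2)]]] by simp

lemma dec_imp:
  assumes "dec P" "dec Q" shows "dec (\<lambda>e. P e \<longrightarrow> Q e)"
  unfolding imp_conv_disj by (intro dec_disj dec_not assms)

lemma recursive_add:
  assumes "recursive f" "recursive g" shows "recursive (\<lambda>e. f e + g e)"
proof -
  have "recursive (\<lambda>e. rec_nat (f e) (\<lambda>_ r. Suc r) (g e))"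
    by (intro recursive_rec_nat recursive_Suc recursive_var assms)
  moreover have "rec_nat x (\<lambda>_ r. Suc r) y = x + y" for x y by (induction y) auto
  ultimately show ?thesis by simp
qed

lemma recursive_mult:
  assumes "recursive f" "recursive g" shows "recursive (\<lambda>e. f e * g e)"
proof -
  have sh: "recursive (\<lambda>e. f (\<lambda>i. e (Suc (Suc i))))"
    using assms(1) by (rule recursive_subst) (rule recursive_var)
  have "recursive (\<lambda>e. rec_nat 0 (\<lambda>_ r. f e + r) (g e))"
    by (intro recursive_rec_nat recursive_add recursive_const recursive_var assms sh)
  moreover have "rec_nat 0 (\<lambda>_ r. x + r) y = x * y" for x y by (induction y) auto
  ultimately show ?thesis by simp
qed

lemma recursive_pred:
  assumes "recursive f" shows "recursive (\<lambda>e. f e - 1)"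
proof -
  have "recursive (\<lambda>e. rec_nat 0 (\<lambda>k _. k) (f e))"
    by (intro recursive_rec_nat recursive_const recursive_var assms)
  moreover have "rec_nat 0 (\<lambda>k _. k) y = y - 1" for y by (cases y) auto
  ultimately show ?thesis by simp
qed

lemma recursive_diff:
  assumes "recursive f" "recursive g" shows "recursive (\<lambda>e. f e - g e)"
proof -
  have "recursive (\<lambda>e. rec_nat (f e) (\<lambda>_ r. r - 1) (g e))"
    by (intro recursive_rec_nat recursive_pred recursive_var assms)
  moreover have "rec_nat x (\<lambda>_ r. r - 1) y = x - y" for x y by (induction y) auto
  ultimately show ?thesis by simp
qed

lemma dec_le:
  assumes "recursive f" "recursive g" shows "dec (\<lambda>e. f e \<le> g e)"
  using dec_zero[OF recursive_diff[OF assms]] by simp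

lemma dec_less:
  assumes "recursive f" "recursive g" shows "dec (\<lambda>e. f e < g e)"
  using dec_le[OF recursive_Suc[OF assms(1)] assms(2)] by (simp add: Suc_le_eq)

lemma dec_eq:
  assumes "recursive f" "recursive g" shows "dec (\<lambda>e. f e = g e)"
  using dec_conj[OF dec_le[OF assms] dec_le[OF assms(2,1)]] by (simp add: eq_iff)

lemma recursive_sum:
  assumes "recursive (\<lambda>e. f (e 0) (\<lambda>i. e (Suc i)))" "recursive n"
  shows "recursive (\<lambda>e. \<Sum>i<n e. f i e)"
proof -
  \<comment> \<open>Inside the recursion entry 1 holds the partial sum, which \<open>f\<close> has
    to skip.\<close>
  have sh: "recursive (\<lambda>e. f (e 0) (\<lambda>i. e (Suc (Suc i))))"
    using recursive_subst[OF assms(1), of "case_nat (\<lambda>e. e 0) (\<lambda>i e. e (Suc (Suc i)))"]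
    by (auto simp: recursive_var split: nat.split)
  have "recursive (\<lambda>e. rec_nat 0 (\<lambda>k r. r + f k e) (n e))"
    by (intro recursive_rec_nat recursive_add recursive_const recursive_var assms sh)
  moreover have "rec_nat 0 (\<lambda>k r. r + f k e) y = (\<Sum>i<y. f i e)" for y e by (induction y) auto
  ultimately show ?thesis by simp
qed

lemma dec_bex:
  assumes "dec (\<lambda>e. P (e 0) (\<lambda>i. e (Suc i)))" "recursive n"
  shows "dec (\<lambda>e. \<exists>i<n e. P i e)"
proof -
  \<comment> \<open>The sum counts the witnesses below the bound.\<close>
  have "recursive (\<lambda>e. \<Sum>i<n e. of_bool (P i e))"
    by (intro recursive_sum assms) (simp add: assms)
  from dec_not[OF dec_zero[OF this]] have "dec (\<lambda>e. (\<Sum>i<n e. of_bool (P i e) :: nat) \<noteq> 0)" .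
  moreover have "(\<Sum>i<n e. of_bool (P i e) :: nat) \<noteq> 0 \<longleftrightarrow> (\<exists>i<n e. P i e)" for e
    by (auto simp: disjoint_iff)
  ultimately show ?thesis by simp
qed

lemma dec_ball:
  assumes "dec (\<lambda>e. P (e 0) (\<lambda>i. e (Suc i)))" "recursive n"
  shows "dec (\<lambda>e. \<forall>i<n e. P i e)"
  using dec_not[OF dec_bex[OF dec_not[OF assms(1)] assms(2)]] by simp

lemma recursive_Least:
  assumes P: "dec (\<lambda>e. P (e 0) (\<lambda>i. e (Suc i)))" and ex: "\<And>e. \<exists>y. P y e"
  shows "recursive (\<lambda>e. LEAST y. P y e)"
proof -
  \<comment> \<open>\<open>Mu\<close> looks for a zero, hence the program for the negation of
    \<open>P\<close>. That program is total, and \<open>ex\<close> lets the search end.\<close>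
  obtain K where K: "\<forall>k\<ge>K. \<exists>c. \<forall>e. rec_run c (map e [0..<k]) =
      Some (of_bool (\<not> P (e 0) (\<lambda>i. e (Suc i))))"
    using dec_not[OF P] unfolding dec_def recursive_def by blast
  show ?thesis unfolding recursive_def
  proof (intro exI[of _ K] allI impI)
    fix k assume "K \<le> k"
    then have "Suc k \<ge> K" by simp
    then obtain c where c: "\<And>e. rec_run c (map e [0..<Suc k]) =
        Some (of_bool (\<not> P (e 0) (\<lambda>i. e (Suc i))))" using K by blast
    have c': "rec_run c (y # map e [0..<k]) = Some (of_bool (\<not> P y e))" for y e
      using c[of "case_nat y e"] by (simp add: map_upt_Suc del: upt_Suc)
    have "rec_run (Mu c) (map e [0..<k]) = Some (LEAST y. P y e)" for e
      using ex[of e] by (simp add: c')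
    then show "\<exists>c. \<forall>e. rec_run c (map e [0..<k]) = Some (LEAST y. P y e)" by blast
  qed
qed

lemma dec_subst:
  assumes "dec P" "\<And>i. recursive (s i)"
  shows "dec (\<lambda>e. P (\<lambda>i. s i e))"
  using recursive_subst[OF assms(1)[unfolded dec_def] assms(2)] by simp

lemma dec_app:
  assumes "dec (\<lambda>e. P (e 0) (\<lambda>i. e (Suc i)))" "recursive n"
  shows "dec (\<lambda>e. P (n e) e)"
  using recursive_app[of "\<lambda>x e. of_bool (P x e)", OF _ assms(2)] assms(1) by simp

section \<open>Closure properties of semidecidable predicates\<close>

lemma re_dec:
  assumes "dec P" shows "re P"
  unfolding re_def
proof (intro exI conjI)
  show "dec (\<lambda>e. (\<lambda>y. P) (e 0) (\<lambda>i. e (Suc i)))"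
    using dec_subst[OF assms, of "\<lambda>i e. e (Suc i)"] by (simp add: recursive_var)
qed simp

lemma re_ex_dec:
  assumes "dec (\<lambda>e. P (e 0) (\<lambda>i. e (Suc i)))"
  shows "re (\<lambda>e. \<exists>y. P y e)"
  using assms unfolding re_def by blast

lemma re_subst:
  assumes "re P" "\<And>i. recursive (s i)"
  shows "re (\<lambda>e. P (\<lambda>i. s i e))"
proof -
  obtain Q where Q: "dec (\<lambda>e. Q (e 0) (\<lambda>i. e (Suc i)))" "\<And>e. P e \<longleftrightarrow> (\<exists>y. Q y e)"
    using assms unfolding re_def by blast
  have "recursive (case_nat (\<lambda>e. e 0) (\<lambda>i e. s i (\<lambda>i. e (Suc i))) i)" for i
    by (cases i) (auto intro: recursive_var recursive_subst[OF assms(2)])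
  from dec_subst[OF Q(1), of "case_nat (\<lambda>e. e 0) (\<lambda>i e. s i (\<lambda>i. e (Suc i)))", OF this]
  have "dec (\<lambda>e. Q (e 0) (\<lambda>i. s i (\<lambda>i. e (Suc i))))" by simp
  from re_ex_dec[OF this] show ?thesis by (simp add: Q(2))
qed

text \<open>Several unbounded witnesses are replaced by a common strict upper bound for them.\<close>

lemma re_ex:
  assumes "re (\<lambda>e. P (e 0) (\<lambda>i. e (Suc i)))"
  shows "re (\<lambda>e. \<exists>y. P y e)"
proof -
  obtain Q where Q: "dec (\<lambda>e. Q (e 0) (\<lambda>i. e (Suc i)))"
      "\<And>e. P (e 0) (\<lambda>i. e (Suc i)) \<longleftrightarrow> (\<exists>y. Q y e)"
    using assms unfolding re_def by blast
  have *: "P x e \<longleftrightarrow> (\<exists>y. Q y (case_nat x e))" for x e using Q(2)[of "case_nat x e"] by simp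
  \<comment> \<open>Under the quantifiers for \<open>b\<close>, \<open>x\<close> and
    \<open>y\<close>, entry 0 is \<open>y\<close>, entry 1 is \<open>x\<close> and entry 2 is
    \<open>b\<close>. The substitution \<open>?s\<close> hides \<open>b\<close> from
    \<open>Q\<close>.\<close>
  let ?s = "case_nat (\<lambda>e. e 0) (case_nat (\<lambda>e. e 1) (\<lambda>i e. e (Suc (Suc (Suc i)))))"
  have "recursive (?s i)" for i
    by (auto simp: recursive_var split: nat.split)
  from dec_subst[OF Q(1), of ?s, OF this]
  have "dec (\<lambda>e. Q (e 0) (\<lambda>i. ?s (Suc i) e))" by simp
  also have "(\<lambda>e. Q (e 0) (\<lambda>i. ?s (Suc i) e)) = (\<lambda>e. Q (e 0) (case_nat (e 1) (\<lambda>i. e (Suc (Suc (Suc i))))))"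
    by (intro ext arg_cong2[of _ _ _ _ Q]) (auto split: nat.split)
  finally have d: "dec (\<lambda>e. Q (e 0) (case_nat (e 1) (\<lambda>i. e (Suc (Suc (Suc i))))))" .
  have "re (\<lambda>e. \<exists>b. \<exists>x<b. \<exists>y<b. Q y (case_nat x e))"
    by (intro re_ex_dec dec_bex recursive_var) (use d in simp)
  moreover have "(\<exists>b. \<exists>x<b. \<exists>y<b. Q y (case_nat x e)) \<longleftrightarrow> (\<exists>y. P y e)" for e
  proof
    assume "\<exists>y. P y e"
    then obtain x y where "Q y (case_nat x e)" by (auto simp: *)
    moreover have "x < Suc (x + y)" "y < Suc (x + y)" by simp_all
    ultimately show "\<exists>b. \<exists>x<b. \<exists>y<b. Q y (case_nat x e)" by blast
  qed (auto simp: *)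
  ultimately show ?thesis by simp
qed

lemma re_conj:
  assumes "re P" "re Q" shows "re (\<lambda>e. P e \<and> Q e)"
proof -
  obtain P' where P': "dec (\<lambda>e. P' (e 0) (\<lambda>i. e (Suc i)))" "\<And>e. P e \<longleftrightarrow> (\<exists>y. P' y e)"
    using assms unfolding re_def by blast
  obtain Q' where Q': "dec (\<lambda>e. Q' (e 0) (\<lambda>i. e (Suc i)))" "\<And>e. Q e \<longleftrightarrow> (\<exists>y. Q' y e)"
    using assms unfolding re_def by blast
  have 1: "dec (\<lambda>e. P' (e 1) (\<lambda>i. e (Suc (Suc i))))"
    using dec_subst[OF P'(1), of "\<lambda>i e. e (Suc i)"] by (simp add: recursive_var)
  have 2: "dec (\<lambda>e. Q' (e 0) (\<lambda>i. e (Suc (Suc i))))"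
    using dec_subst[OF Q'(1), of "case_nat (\<lambda>e. e 0) (\<lambda>i e. e (Suc (Suc i)))"]
    by (simp add: recursive_var split: nat.split)
  have "re (\<lambda>e. \<exists>y z. P' y e \<and> Q' z e)"
    by (intro re_ex re_dec dec_conj) (use 1 2 in simp_all)
  then show ?thesis by (simp add: P' Q')
qed

lemma re_disj:
  assumes "re P" "re Q" shows "re (\<lambda>e. P e \<or> Q e)"
proof -
  obtain P' where P': "dec (\<lambda>e. P' (e 0) (\<lambda>i. e (Suc i)))" "\<And>e. P e \<longleftrightarrow> (\<exists>y. P' y e)"
    using assms unfolding re_def by blast
  obtain Q' where Q': "dec (\<lambda>e. Q' (e 0) (\<lambda>i. e (Suc i)))" "\<And>e. Q e \<longleftrightarrow> (\<exists>y. Q' y e)"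
    using assms unfolding re_def by blast
  have "re (\<lambda>e. \<exists>y. P' y e \<or> Q' y e)"
    by (intro re_ex_dec dec_disj P' Q')
  then show ?thesis by (simp add: P' Q' ex_disj_distrib)
qed

text \<open>Collection: the finitely many witnesses for \<open>i < n e\<close> have a common strict
  bound, one more than their sum, so the unbounded quantifier can be moved to the front.\<close>

lemma re_ball:
  assumes "re (\<lambda>e. P (e 0) (\<lambda>i. e (Suc i)))" and n: "recursive n"
  shows "re (\<lambda>e. \<forall>i<n e. P i e)"
proof -
  obtain Q where Q: "dec (\<lambda>e. Q (e 0) (\<lambda>i. e (Suc i)))"
      "\<And>e. P (e 0) (\<lambda>i. e (Suc i)) \<longleftrightarrow> (\<exists>y. Q y e)"
    using assms unfolding re_def by blast
  have *: "P x e \<longleftrightarrow> (\<exists>y. Q y (case_nat x e))" for x e using Q(2)[of "case_nat x e"] by simp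
  let ?s = "case_nat (\<lambda>e. e 0) (case_nat (\<lambda>e. e 1) (\<lambda>i e. e (Suc (Suc (Suc i)))))"
  have "recursive (?s i)" for i
    by (auto simp: recursive_var split: nat.split)
  from dec_subst[OF Q(1), of ?s, OF this]
  have "dec (\<lambda>e. Q (e 0) (\<lambda>i. ?s (Suc i) e))" by simp
  also have "(\<lambda>e. Q (e 0) (\<lambda>i. ?s (Suc i) e)) = (\<lambda>e. Q (e 0) (case_nat (e 1) (\<lambda>i. e (Suc (Suc (Suc i))))))"
    by (intro ext arg_cong2[of _ _ _ _ Q]) (auto split: nat.split)
  finally have d: "dec (\<lambda>e. Q (e 0) (case_nat (e 1) (\<lambda>i. e (Suc (Suc (Suc i))))))" .
  have n': "recursive (\<lambda>e. n (\<lambda>i. e (Suc i)))"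
    using n by (rule recursive_subst) (rule recursive_var)
  have "re (\<lambda>e. \<exists>b. \<forall>x<n e. \<exists>y<b. Q y (case_nat x e))"
    by (intro re_ex_dec dec_bex dec_ball recursive_var) (use d n' in simp_all)
  moreover have "(\<exists>b. \<forall>x<n e. \<exists>y<b. Q y (case_nat x e)) \<longleftrightarrow> (\<forall>i<n e. P i e)" for e
  proof
    assume "\<forall>i<n e. P i e"
    then obtain y where y: "\<And>x. x < n e \<Longrightarrow> Q (y x) (case_nat x e)" unfolding * by metis
    have "y x < Suc (\<Sum>x<n e. y x)" if "x < n e" for x
      using that by (simp add: less_Suc_eq_le member_le_sum)
    with y show "\<exists>b. \<forall>x<n e. \<exists>y<b. Q y (case_nat x e)" by meson
  qed (auto simp: *)
  ultimately show ?thesis by simp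
qed

text \<open>Post's theorem. The search for the least number that witnesses either \<open>P\<close>
  or its negation always ends, and testing which of the two it witnesses decides
  \<open>P\<close>.\<close>

lemma dec_re_compl:
  assumes "re P" "re (\<lambda>e. \<not> P e)" shows "dec P"
proof -
  obtain P' where P': "dec (\<lambda>e. P' (e 0) (\<lambda>i. e (Suc i)))" "\<And>e. P e \<longleftrightarrow> (\<exists>y. P' y e)"
    using assms unfolding re_def by blast
  obtain Q' where Q': "dec (\<lambda>e. Q' (e 0) (\<lambda>i. e (Suc i)))" "\<And>e. \<not> P e \<longleftrightarrow> (\<exists>y. Q' y e)"
    using assms unfolding re_def by blast
  let ?n = "\<lambda>e. LEAST y. P' y e \<or> Q' y e"
  have ex: "\<exists>y. P' y e \<or> Q' y e" for e using P'(2) Q'(2) by blast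
  have "recursive ?n"
    by (intro recursive_Least dec_disj P' Q' ex)
  from dec_app[OF P'(1) this] have "dec (\<lambda>e. P' (?n e) e)" .
  moreover have "P' (?n e) e \<longleftrightarrow> P e" for e
    using LeastI_ex[OF ex[of e]] P'(2)[of e] Q'(2)[of e] by blast
  ultimately show ?thesis by simp
qed

text \<open>\<open>dec\<close> provides programs for large arities only; padding the single input
  with zeros makes one of them unary.\<close>

lemma decidable_set_dec:
  assumes "dec (\<lambda>e. e 0 \<in> A)" shows "decidable_set A"
proof -
  obtain k c where c: "\<And>e. rec_run c (map e [0..<Suc k]) = Some (of_bool (e 0 \<in> A))"
    using assms unfolding dec_def recursive_def by (meson le_SucI order_refl)
  let ?c = "Comp c (Proj 0 # replicate k Zero)"
  have "rec_run ?c [n] = Some (if n \<in> A then 1 else 0)" for n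
  proof -
    have "map (\<lambda>g. rec_run g [n]) (Proj 0 # replicate k Zero) =
        map Some (map (case_nat n (\<lambda>_. 0)) [0..<Suc k])"
      by (simp add: map_upt_Suc map_replicate_const o_def del: upt_Suc)
    then show ?thesis
      using those_map_Some[of "\<lambda>x. x" "map (case_nat n (\<lambda>_. 0)) [0..<Suc k]"]
        c[of "case_nat n (\<lambda>_. 0)"] by (simp del: upt_Suc)
  qed
  then show ?thesis unfolding decidable_set_def by blast
qed

section \<open>Sequences of vectors over a finite set\<close>

text \<open>Any sequence has a monotone subsequence. If that one is decreasing, it is constant from
  a position where its minimum is attained.\<close>

lemma incseq_subseq_nat:
  fixes f :: "nat \<Rightarrow> nat"
  shows "\<exists>r :: nat \<Rightarrow> nat. strict_mono r \<and> mono (\<lambda>n. f (r n))"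
proof -
  obtain r :: "nat \<Rightarrow> nat" where r: "strict_mono r" "monoseq (\<lambda>n. f (r n))" using seq_monosub by blast
  show ?thesis
  proof (cases "incseq (\<lambda>n. f (r n))")
    case False
    then have dec: "f (r j) \<le> f (r i)" if "i \<le> j" for i j
      using r(2) that by (auto simp: monoseq_iff decseq_def)
    obtain k where k: "\<And>n. f (r k) \<le> f (r n)"
      using ex_has_least_nat[of "\<lambda>_. True" _ "\<lambda>n. f (r n)"] by auto
    have "f (r (n + k)) = f (r k)" for n using dec[of k "n + k"] k[of "n + k"] by simp
    moreover have "strict_mono (\<lambda>n. r (n + k))" using r(1) by (simp add: strict_mono_def)
    ultimately show ?thesis by (intro exI[of _ "\<lambda>n. r (n + k)"]) (simp add: mono_def)
  qed (use r in auto)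
qed

text \<open>Dickson's lemma: the subsequence is refined one coordinate at a time, and refining keeps
  the earlier coordinates monotone.\<close>

lemma dickson_subseq:
  fixes f :: "nat \<Rightarrow> 's \<Rightarrow> nat"
  assumes "finite S"
  shows "\<exists>r :: nat \<Rightarrow> nat. strict_mono r \<and> (\<forall>q\<in>S. mono (\<lambda>n. f (r n) q))"
  using assms
proof (induction S)
  case empty
  show ?case by (intro exI[of _ id]) (simp add: strict_mono_def)
next
  case (insert x S)
  then obtain r :: "nat \<Rightarrow> nat" where r: "strict_mono r" "\<forall>q\<in>S. mono (\<lambda>n. f (r n) q)" by blast
  obtain s :: "nat \<Rightarrow> nat" where s: "strict_mono s" "mono (\<lambda>n. f (r (s n)) x)"
    using incseq_subseq_nat[of "\<lambda>n. f (r n) x"] by blast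
  have "strict_mono (\<lambda>n. r (s n))" using r(1) s(1) by (simp add: strict_mono_def)
  moreover have "mono (\<lambda>n. f (r (s n)) q)" if "q \<in> S" for q
    using r(2) s(1) that by (simp add: mono_def strict_mono_less_eq)
  ultimately show ?case using s(2) by blast
qed

text \<open>Otherwise each bound \<open>Suc n\<close> fails at some \<open>u n\<close>. Let
  \<open>r\<close> be a Dickson subsequence and \<open>k\<close> a bound on the entries of
  \<open>u (r 0)\<close>. Since \<open>r k\<close> is at least \<open>k\<close>,
  \<open>u (r 0)\<close> lies below the truncation of \<open>u (r k)\<close>, so it satisfies
  \<open>D\<close>, a contradiction. The bound is not computed; the semidecision procedure will
  search for it.\<close>

lemma truncation_bound:
  fixes D :: "('s \<Rightarrow> nat) \<Rightarrow> bool"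
  assumes "finite S" and down: "\<And>u v. D v \<Longrightarrow> (\<And>q. q \<in> S \<Longrightarrow> u q \<le> v q) \<Longrightarrow> D u"
  shows "\<exists>B\<ge>1. \<forall>u. D (\<lambda>q. min B (u q)) \<longrightarrow> D u"
proof (rule ccontr)
  assume "\<not> ?thesis"
  then have "\<forall>n. \<exists>u. D (\<lambda>q. min (Suc n) (u q)) \<and> \<not> D u" by (metis le_add1 plus_1_eq_Suc)
  then obtain u where u: "\<And>n. D (\<lambda>q. min (Suc n) (u n q))" "\<And>n. \<not> D (u n)" by metis
  obtain r :: "nat \<Rightarrow> nat" where r: "strict_mono r" "\<forall>q\<in>S. mono (\<lambda>n. u (r n) q)"
    using dickson_subseq[OF assms(1)] by blast
  define k where "k = (\<Sum>q\<in>S. u (r 0) q)"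
  have "D (u (r 0))"
  proof (rule down[OF u(1)[of "r k"]])
    fix q assume q: "q \<in> S"
    have "u (r 0) q \<le> k" using q assms(1) unfolding k_def by (simp add: member_le_sum)
    also have "k \<le> r k" using r(1) by (rule strict_mono_imp_increasing)
    finally show "u (r 0) q \<le> min (Suc (r k)) (u (r k) q)"
      using r(2) q by (simp add: mono_def)
  qed
  with u(2) show False by blast
qed

section \<open>Linear inequalities\<close>

text \<open>A pair \<open>(f, c)\<close> stands for the inequality stating that \<open>c\<close> is
  at most the linear form with coefficients \<open>f\<close>. Sums with repetition give all positive
  integer combinations.\<close>

inductive_set add_hull :: "(('j \<Rightarrow> int) \<times> int) set \<Rightarrow> (('j \<Rightarrow> int) \<times> int) set" for L where
  base: "l \<in> L \<Longrightarrow> l \<in> add_hull L"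
| add: "(f, c) \<in> add_hull L \<Longrightarrow> (g, d) \<in> add_hull L \<Longrightarrow> (\<lambda>j. f j + g j, c + d) \<in> add_hull L"

lemma add_hull_mult:
  assumes "(f, c) \<in> add_hull L" "n > 0"
  shows "(\<lambda>j. n * f j, n * c) \<in> add_hull L"
proof -
  have "(\<lambda>j. int (Suc k) * f j, int (Suc k) * c) \<in> add_hull L" for k
  proof (induction k)
    case (Suc k)
    from add_hull.add[OF assms(1) this] show ?case by (simp add: algebra_simps)
  qed (use assms in simp)
  from this[of "nat n - 1"] assms(2) show ?thesis by simp
qed

lemma add_hull_subset:
  assumes "L' \<subseteq> add_hull L" shows "add_hull L' \<subseteq> add_hull L"
proof
  fix l assume "l \<in> add_hull L'"
  then show "l \<in> add_hull L"
    by induction (use assms in \<open>auto intro: add_hull.add\<close>)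
qed

lemma between_finite_sets:
  fixes A B :: "'a :: linordered_field set"
  assumes "finite A" "finite B" "\<And>a b. a \<in> A \<Longrightarrow> b \<in> B \<Longrightarrow> a \<le> b"
  shows "\<exists>t. (\<forall>a\<in>A. a \<le> t) \<and> (\<forall>b\<in>B. t \<le> b)"
proof (cases "A = {}")
  case True
  then show ?thesis
    using assms by (cases "B = {}") (auto intro!: exI[of _ "Min B"])
next
  case False
  then show ?thesis using assms by (intro exI[of _ "Max A"]) auto
qed

text \<open>Fourier--Motzkin elimination. Taking integer coefficients makes all the combinations that
  occur sums of the given inequalities.\<close>

lemma farkas:
  fixes L :: "(('j \<Rightarrow> int) \<times> int) set"
  assumes "finite J" "finite L"
  shows "(\<exists>x :: 'j \<Rightarrow> rat. \<forall>(f, c)\<in>L. of_int c \<le> (\<Sum>j\<in>J. of_int (f j) * x j)) \<or>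
         (\<exists>(f, c)\<in>add_hull L. (\<forall>j\<in>J. f j = 0) \<and> c > 0)"
  using assms
proof (induction J arbitrary: L)
  case empty
  show ?case
  proof (cases "\<exists>(f, c)\<in>L. c > 0")
    case True
    then show ?thesis by (auto intro: add_hull.base)
  qed force
next
  case (insert k J)
  define P where "P = {l\<in>L. fst l k > 0}"
  define M where "M = {l\<in>L. fst l k < 0}"
  \<comment> \<open>The multipliers \<open>- fst h k\<close> and \<open>fst l k\<close> are both
    positive, and they cancel the coefficient of \<open>k\<close>.\<close>
  define comb where "comb = (\<lambda>(l :: ('j \<Rightarrow> int) \<times> int, h :: ('j \<Rightarrow> int) \<times> int).
    (\<lambda>j. - fst h k * fst l j + fst l k * fst h j, - fst h k * snd l + fst l k * snd h))"
  define L' where "L' = {l\<in>L. fst l k = 0} \<union> comb ` (P \<times> M)"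
  have fin: "finite P" "finite M" "finite L'" using insert.prems by (auto simp: P_def M_def L'_def)
  have "L' \<subseteq> add_hull L"
  proof -
    have "comb (l, h) \<in> add_hull L" if "l \<in> P" "h \<in> M" for l h
      unfolding comb_def prod.case
      using that by (intro add_hull.add add_hull_mult) (auto simp: P_def M_def intro: add_hull.base)
    then show ?thesis by (auto simp: L'_def intro: add_hull.base)
  qed
  then have hull: "add_hull L' \<subseteq> add_hull L" by (rule add_hull_subset)
  have zero: "fst l k = 0" if "l \<in> add_hull L'" for l
    using that by induction (auto simp: L'_def comb_def)
  from insert.IH[OF fin(3)] show ?case
  proof
    assume "\<exists>(f, c)\<in>add_hull L'. (\<forall>j\<in>J. f j = 0) \<and> c > 0"
    then show ?thesis using hull zero by fastforce
  next
    assume "\<exists>x :: 'j \<Rightarrow> rat. \<forall>(f, c)\<in>L'. of_int c \<le> (\<Sum>j\<in>J. of_int (f j) * x j)"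
    then obtain x :: "'j \<Rightarrow> rat" where
      x: "\<And>f c. (f, c) \<in> L' \<Longrightarrow> of_int c \<le> (\<Sum>j\<in>J. of_int (f j) * x j)" by blast
    define s where "s l = (\<Sum>j\<in>J. of_int (fst l j) * x j)" for l :: "('j \<Rightarrow> int) \<times> int"
    \<comment> \<open>The bound that \<open>l\<close> puts on the eliminated variable once the
      others have the values \<open>x\<close>: a lower bound for \<open>l\<close> in
      \<open>P\<close>, an upper one for \<open>l\<close> in \<open>M\<close>.\<close>
    define bd where "bd l = (of_int (snd l) - s l) / of_int (fst l k)" for l
    have "bd l \<le> bd h" if "l \<in> P" "h \<in> M" for l h
    proof -
      have "comb (l, h) \<in> L'" using that by (auto simp: L'_def)
      then have "of_int (- fst h k * snd l + fst l k * snd h) \<le>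
          (\<Sum>j\<in>J. of_int (- fst h k * fst l j + fst l k * fst h j) * x j)"
        using x unfolding comb_def prod.case by blast
      also have "\<dots> = - of_int (fst h k) * s l + of_int (fst l k) * s h"
        by (simp add: s_def sum_distrib_left sum.distrib sum_subtractf algebra_simps sum_negf)
      finally have "- of_int (fst h k) * (of_int (snd l) - s l) \<le> of_int (fst l k) * (s h - of_int (snd h))"
        by (simp add: algebra_simps)
      moreover have "(of_int (fst l k) :: rat) > 0" "(of_int (fst h k) :: rat) < 0"
        using that by (auto simp: P_def M_def)
      ultimately show ?thesis unfolding bd_def by (simp add: field_simps)
    qed
    then have "\<exists>t. (\<forall>a\<in>bd ` P. a \<le> t) \<and> (\<forall>b\<in>bd ` M. t \<le> b)"
      by (intro between_finite_sets finite_imageI fin) (elim imageE, simp)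
    then obtain t where t: "\<And>l. l \<in> P \<Longrightarrow> bd l \<le> t" "\<And>h. h \<in> M \<Longrightarrow> t \<le> bd h"
      by (auto simp del: split_paired_All split_paired_Ex)
    have sk: "(\<Sum>j\<in>insert k J. of_int (f j) * (x(k := t)) j) = of_int (f k) * t + s (f, c)" for f c
    proof -
      have "(\<Sum>j\<in>J. of_int (f j) * (x(k := t)) j) = s (f, c)"
        unfolding s_def using insert.hyps by (intro sum.cong) auto
      then show ?thesis using insert.hyps by simp
    qed
    have "of_int c \<le> of_int (f k) * t + s (f, c)" if l: "(f, c) \<in> L" for f c
    proof (cases "f k" "0 :: int" rule: linorder_cases)
      case equal
      then show ?thesis using x[of f c] l by (simp add: L'_def s_def)
    next
      case greater
      then have "bd (f, c) \<le> t" using l t by (simp add: P_def)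
      moreover have "(of_int (f k) :: rat) > 0" using greater by simp
      ultimately show ?thesis by (simp add: bd_def field_simps)
    next
      case less
      then have "t \<le> bd (f, c)" using l t by (simp add: M_def)
      moreover have "(of_int (f k) :: rat) < 0" using less by simp
      ultimately show ?thesis by (simp add: bd_def field_simps)
    qed
    then have "\<forall>(f, c)\<in>L. of_int c \<le> (\<Sum>j\<in>insert k J. of_int (f j) * (x(k := t)) j)"
      using sk by fastforce
    then show ?thesis by blast
  qed
qed

lemma common_denominator:
  fixes x :: "'j \<Rightarrow> rat"
  assumes "finite J"
  shows "\<exists>d :: int. d > 0 \<and> (\<forall>j\<in>J. of_int d * x j \<in> \<int>)"
  using assms
proof (induction J)
  case empty
  show ?case by (intro exI[of _ 1]) simp
next
  case (insert k J)
  then obtain d :: int where d: "d > 0" "\<forall>j\<in>J. of_int d * x j \<in> \<int>" by blast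
  obtain a b where ab: "quotient_of (x k) = (a, b)" by fastforce
  have b: "b > 0" "x k = of_int a / of_int b"
    using quotient_of_denom_pos[OF ab] quotient_of_div[OF ab] by auto
  have "of_int (b * d) * x j \<in> \<int>" if "j \<in> insert k J" for j
  proof (cases "j = k")
    case True
    have "of_int (b * d) * x k = of_int (d * a)" using b by simp
    then show ?thesis using True by (metis Ints_of_int)
  next
    case False
    then have "of_int d * x j \<in> \<int>" using d that by blast
    then have "of_int b * (of_int d * x j) \<in> \<int>" by (rule Ints_mult[OF Ints_of_int])
    then show ?thesis by (simp add: mult.assoc)
  qed
  then show ?case using b d by (intro exI[of _ "b * d"]) simp
qed

text \<open>\<open>farkas\<close> is applied to the homogeneous rows of \<open>A\<close> together
  with the inequalities \<open>x k >= 1\<close>. A rational solution is scaled to integers. A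
  refutation uses the rows with multiplicities \<open>y\<close> and the other inequalities with
  multiplicities \<open>z\<close>; its left side vanishes, so column \<open>j\<close> of the
  combined rows is \<open>- z j\<close>, and its positive right side makes some \<open>z j\<close>
  nonzero.\<close>

lemma tucker:
  fixes A :: "'i \<Rightarrow> 'j \<Rightarrow> int"
  assumes "finite I" "finite J"
  shows "(\<exists>x :: 'j \<Rightarrow> nat. (\<forall>j\<in>J. x j \<ge> 1) \<and> (\<forall>i\<in>I. 0 \<le> (\<Sum>j\<in>J. A i j * int (x j)))) \<or>
         (\<exists>y :: 'i \<Rightarrow> nat. (\<forall>j\<in>J. (\<Sum>i\<in>I. int (y i) * A i j) \<le> 0) \<and>
            (\<exists>j\<in>J. (\<Sum>i\<in>I. int (y i) * A i j) < 0))"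
proof -
  define L where "L = (\<lambda>i. (A i, 0 :: int)) ` I \<union> (\<lambda>k. (\<lambda>j. of_bool (j = k), 1)) ` J"
  have "finite L" using assms by (simp add: L_def)
  from farkas[OF assms(2) this] show ?thesis
  proof
    assume "\<exists>x :: 'j \<Rightarrow> rat. \<forall>(f, c)\<in>L. of_int c \<le> (\<Sum>j\<in>J. of_int (f j) * x j)"
    then obtain x :: "'j \<Rightarrow> rat" where
      x: "\<And>f c. (f, c) \<in> L \<Longrightarrow> of_int c \<le> (\<Sum>j\<in>J. of_int (f j) * x j)" by blast
    have x1: "x k \<ge> 1" if "k \<in> J" for k
    proof -
      have "of_int 1 \<le> (\<Sum>j\<in>J. of_int (of_bool (j = k)) * x j)"
        using that by (intro x) (auto simp: L_def)
      also have "\<dots> = (\<Sum>j\<in>J. if j = k then x j else 0)" by (intro sum.cong) auto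
      finally show ?thesis using that assms(2) by simp
    qed
    obtain d :: int where d: "d > 0" "\<forall>j\<in>J. of_int d * x j \<in> \<int>"
      using common_denominator[OF assms(2)] by blast
    have "\<exists>n::nat. of_nat n = of_int d * x j" if "j \<in> J" for j
    proof -
      have "of_int d * x j \<in> \<int>" "of_int d * x j \<ge> 0" using d x1[OF that] that by auto
      then show ?thesis by (metis Nats_altdef2 Nats_cases mem_Collect_eq)
    qed
    then obtain n where n: "\<And>j. j \<in> J \<Longrightarrow> (of_nat (n j) :: rat) = of_int d * x j" by metis
    have "n j \<ge> 1" if "j \<in> J" for j
    proof -
      have "0 < of_int d * x j" using d x1[OF that] by simp
      then show ?thesis using n[OF that] by (cases "n j") auto
    qed
    moreover have "0 \<le> (\<Sum>j\<in>J. A i j * int (n j))" if "i \<in> I" for i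
    proof -
      have "0 \<le> (\<Sum>j\<in>J. of_int (A i j) * x j)" using x[of "A i" 0] that by (auto simp: L_def)
      then have "0 \<le> of_int d * (\<Sum>j\<in>J. of_int (A i j) * x j)" using d(1) by simp
      also have "\<dots> = (\<Sum>j\<in>J. of_int (A i j) * of_nat (n j))"
        by (simp add: sum_distrib_left n algebra_simps)
      also have "\<dots> = of_int (\<Sum>j\<in>J. A i j * int (n j))" by simp
      finally show ?thesis by (simp only: of_int_0_le_iff)
    qed
    ultimately show ?thesis by blast
  next
    assume "\<exists>(f, c)\<in>add_hull L. (\<forall>j\<in>J. f j = 0) \<and> c > 0"
    then obtain f c where fc: "(f, c) \<in> add_hull L" "\<forall>j\<in>J. f j = 0" "c > 0" by blast
    \<comment> \<open>\<open>y i\<close> and \<open>z j\<close> count how often row \<open>i\<close>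
      and the inequality \<open>x j >= 1\<close> occur in the sum \<open>l\<close>.\<close>
    have "\<exists>(y :: 'i \<Rightarrow> nat) (z :: 'j \<Rightarrow> nat).
        (\<forall>j\<in>J. fst l j = (\<Sum>i\<in>I. int (y i) * A i j) + int (z j)) \<and> snd l = (\<Sum>j\<in>J. int (z j))"
      if "l \<in> add_hull L" for l
      using that
    proof induction
      case (base l)
      then consider i where "i \<in> I" "l = (A i, 0)" | k where "k \<in> J" "l = (\<lambda>j. of_bool (j = k), 1)"
        by (auto simp: L_def)
      then show ?case
      proof cases
        case 1
        have "(\<Sum>k\<in>I. int (of_bool (k = i)) * A k j) = (\<Sum>k\<in>I. if k = i then A k j else 0)" for j
          by (intro sum.cong) auto
        then show ?thesis using 1 assms(1)
          by (intro exI[of _ "\<lambda>k. of_bool (k = i)"] exI[of _ "\<lambda>_. 0"]) simp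
      next
        case 2
        have "(\<Sum>j\<in>J. int (of_bool (j = k))) = (\<Sum>j\<in>J. if j = k then 1 else 0)"
          by (intro sum.cong) auto
        then show ?thesis using 2 assms(2)
          by (intro exI[of _ "\<lambda>_. 0"] exI[of _ "\<lambda>j. of_bool (j = k)"]) simp
      qed
    next
      case (add f c g d)
      then obtain y z y' z' where
        "\<forall>j\<in>J. f j = (\<Sum>i\<in>I. int (y i) * A i j) + int (z j)" "c = (\<Sum>j\<in>J. int (z j))"
        "\<forall>j\<in>J. g j = (\<Sum>i\<in>I. int (y' i) * A i j) + int (z' j)" "d = (\<Sum>j\<in>J. int (z' j))"
        by auto
      then show ?case
        by (intro exI[of _ "\<lambda>i. y i + y' i"] exI[of _ "\<lambda>j. z j + z' j"])
          (simp add: sum.distrib algebra_simps)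
    qed
    from this[OF fc(1)] obtain y :: "'i \<Rightarrow> nat" and z :: "'j \<Rightarrow> nat" where
      yz: "\<forall>j\<in>J. f j = (\<Sum>i\<in>I. int (y i) * A i j) + int (z j)" "c = (\<Sum>j\<in>J. int (z j))"
      by auto
    have *: "(\<Sum>i\<in>I. int (y i) * A i j) = - int (z j)" if "j \<in> J" for j
      using yz(1) fc(2) that by (metis eq_neg_iff_add_eq_0)
    have "\<exists>j\<in>J. z j \<noteq> 0"
    proof (rule ccontr)
      assume "\<not> ?thesis"
      with yz(2) fc(3) show False by simp
    qed
    then have "(\<forall>j\<in>J. (\<Sum>i\<in>I. int (y i) * A i j) \<le> 0) \<and> (\<exists>j\<in>J. (\<Sum>i\<in>I. int (y i) * A i j) < 0)"
      using * by force
    then show ?thesis by blast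
  qed
qed

section \<open>Closed walks in directed graphs\<close>

context
  fixes src tgt :: "'e \<Rightarrow> 'v"
begin

fun walk :: "'v \<Rightarrow> 'e list \<Rightarrow> 'v \<Rightarrow> bool" where
  "walk u [] v \<longleftrightarrow> u = v"
| "walk u (e # l) v \<longleftrightarrow> src e = u \<and> walk (tgt e) l v"

text \<open>\<open>X\<close> witnesses that strong connectivity fails: no path in \<open>E\<close>
  leads from the target of an edge ending in \<open>X\<close> to a source outside. Such an
  \<open>X\<close> can be searched for.\<close>

definition splits :: "'e set \<Rightarrow> bool" where
  "splits E \<longleftrightarrow> (\<exists>X. (\<exists>e\<in>E. tgt e \<in> X) \<and> (\<exists>e\<in>E. src e \<notin> X) \<and> (\<forall>e\<in>E. src e \<in> X \<longrightarrow> tgt e \<in> X))"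

lemma walk_append: "walk u (l @ l') v \<longleftrightarrow> (\<exists>w. walk u l w \<and> walk w l' v)"
  by (induction l arbitrary: u) auto

text \<open>The nodes reachable from \<open>tgt e\<close> form a set closed under \<open>E\<close>;
  if it missed some \<open>src f\<close>, then \<open>E\<close> would split. So any two edges can be
  joined, and a closed walk is enlarged by a detour through one edge after the other.\<close>

lemma closed_walk_cover:
  assumes "\<not> splits E" "finite E" "E \<noteq> {}"
  shows "\<exists>u l. walk u l u \<and> set l = E"
proof -
  have conn: "\<exists>l. walk (tgt e) l (src f) \<and> set l \<subseteq> E" if "e \<in> E" "f \<in> E" for e f
  proof -
    define X where "X = {v. \<exists>l. walk (tgt e) l v \<and> set l \<subseteq> E}"
    have "tgt e \<in> X" by (auto simp: X_def intro: exI[of _ "[]"])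
    moreover have "tgt g \<in> X" if "g \<in> E" "src g \<in> X" for g
    proof -
      from that(2) obtain l where "walk (tgt e) l (src g)" "set l \<subseteq> E" by (auto simp: X_def)
      then have "walk (tgt e) (l @ [g]) (tgt g) \<and> set (l @ [g]) \<subseteq> E"
        using that by (simp add: walk_append)
      then show ?thesis unfolding X_def by blast
    qed
    ultimately have "src f \<in> X" using assms(1) \<open>e \<in> E\<close> \<open>f \<in> E\<close> unfolding splits_def by blast
    then show ?thesis by (simp add: X_def)
  qed
  obtain e0 where e0: "e0 \<in> E" using assms by blast
  have "\<exists>l. walk (src e0) l (src e0) \<and> F \<subseteq> set l \<and> set l \<subseteq> E" if "finite F" "F \<subseteq> E" for F
    using that
  proof (induction F)
    case empty
    show ?case by (intro exI[of _ "[]"]) simp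
  next
    case (insert f F)
    then obtain l where l: "walk (src e0) l (src e0)" "F \<subseteq> set l" "set l \<subseteq> E" by blast
    obtain l1 where "walk (tgt e0) l1 (src f)" "set l1 \<subseteq> E" using conn e0 insert.prems by blast
    then have l1: "walk (src e0) (e0 # l1) (src f)" "set (e0 # l1) \<subseteq> E" using e0 by simp_all
    obtain l2 where l2: "walk (tgt f) l2 (src e0)" "set l2 \<subseteq> E" using conn e0 insert.prems by blast
    have "walk (src e0) (l @ (e0 # l1) @ f # l2) (src e0)" using l l1 l2 by (auto simp: walk_append)
    then show ?case using l l1 l2 insert.prems by (intro exI[of _ "l @ (e0 # l1) @ f # l2"]) auto
  qed
  from this[OF assms(2) order_refl] show ?thesis by blast
qed

definition outdeg :: "'e multiset \<Rightarrow> 'v \<Rightarrow> nat" where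
  "outdeg z v = (\<Sum>e\<in>#z. of_bool (src e = v))"

definition indeg :: "'e multiset \<Rightarrow> 'v \<Rightarrow> nat" where
  "indeg z v = (\<Sum>e\<in>#z. of_bool (tgt e = v))"

lemma walk_degrees:
  "walk u l v \<Longrightarrow> outdeg (mset l) x + of_bool (v = x) = indeg (mset l) x + of_bool (u = x)"
  by (induction l arbitrary: u) (fastforce simp: outdeg_def indeg_def)+

lemma degrees_add:
  "outdeg (y + z) v = outdeg y v + outdeg z v" "indeg (y + z) v = indeg y v + indeg z v"
  by (simp_all add: outdeg_def indeg_def)

lemma closed_trail:
  assumes "z \<noteq> {#}" and deg: "\<And>v. indeg z v \<le> outdeg z v"
  shows "\<exists>u l. l \<noteq> [] \<and> walk u l u \<and> mset l \<subseteq># z"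
proof -
  obtain e where e: "e \<in># z" using assms(1) by blast
  let ?P = "\<lambda>l. l \<noteq> [] \<and> mset l \<subseteq># z \<and> (\<exists>v. walk (src e) l v)"
  have "?P [e]" using e by simp
  moreover have "\<forall>l. ?P l \<longrightarrow> length l < Suc (size z)"
    by (metis less_Suc_eq_le size_mset size_mset_mono)
  ultimately obtain l where l: "?P l" "\<And>l'. ?P l' \<Longrightarrow> length l' \<le> length l"
    using ex_has_greatest_nat[of ?P "[e]" length "Suc (size z)"] by blast
  then obtain v where v: "walk (src e) l v" by blast
  have "v = src e"
  proof (rule ccontr)
    assume ne: "v \<noteq> src e"
    obtain y where y: "z = mset l + y" using l(1) by (metis mset_subset_eq_exists_conv)
    have "outdeg y v > 0"
      using deg[of v] walk_degrees[OF v, of v] ne by (simp add: y degrees_add)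
    moreover have "outdeg y v = 0" if "\<forall>f\<in>#y. src f \<noteq> v"
      using that by (auto simp: outdeg_def)
    ultimately obtain f where f: "f \<in># y" "src f = v" by fastforce
    have "?P (l @ [f])" using l(1) v f by (auto simp: y walk_append)
    from l(2)[OF this] show False by simp
  qed
  then show ?thesis using l(1) v by blast
qed

text \<open>Euler's splicing. A closed trail \<open>l\<close> is removed from \<open>z\<close>, and
  the rest is absorbed by induction. The resulting walk still contains all edges of
  \<open>p\<close>, among them the first edge of \<open>l\<close>, so it passes through the starting
  node of \<open>l\<close>, where \<open>l\<close> is inserted.\<close>

lemma closed_walk_extend:
  assumes "walk u p u" "set_mset z \<subseteq> set p" "\<And>v. indeg z v \<le> outdeg z v"
  shows "\<exists>l. walk u l u \<and> mset l = mset p + z"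
  using assms(2,3)
proof (induction "size z" arbitrary: z rule: less_induct)
  case less
  show ?case
  proof (cases "z = {#}")
    case True
    then show ?thesis using assms(1) by auto
  next
    case False
    from closed_trail[OF this less.prems(2)] obtain s l where
      l: "l \<noteq> []" "walk s l s" "mset l \<subseteq># z" by blast
    then obtain y where y: "z = mset l + y" by (metis mset_subset_eq_exists_conv)
    have "indeg y v \<le> outdeg y v" for v
      using less.prems(2)[of v] walk_degrees[OF l(2), of v] by (simp add: y degrees_add)
    moreover have "size y < size z" using l(1) by (simp add: y)
    moreover have "set_mset y \<subseteq> set p" using less.prems(1) by (simp add: y)
    ultimately obtain r where r: "walk u r u" "mset r = mset p + y" using less.hyps by blast
    obtain e l' where "l = e # l'" using l(1) by (cases l) auto
    then have "e \<in> set p" "src e = s" using less.prems(1) l(2) by (auto simp: y)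
    then have "e \<in> set r" using r(2) by (metis set_mset_mset UnCI set_mset_union)
    then obtain r1 r2 where r12: "r = r1 @ e # r2" by (meson split_list)
    have "walk u (r1 @ l @ e # r2) u" using r(1) l(2) \<open>src e = s\<close> by (auto simp: r12 walk_append)
    moreover have "mset (r1 @ l @ e # r2) = mset p + z" using r(2) by (simp add: r12 y)
    ultimately show ?thesis by blast
  qed
qed

text \<open>\<open>h\<close> is dual to the flow conditions at the nodes.\<close>

lemma nonneg_closed_walk:
  fixes A :: "'i \<Rightarrow> 'e \<Rightarrow> int"
  assumes "finite E" "E \<noteq> {}" "finite I" "\<not> splits E"
  shows "(\<exists>u l. l \<noteq> [] \<and> walk u l u \<and> set l \<subseteq> E \<and> (\<forall>i\<in>I. 0 \<le> (\<Sum>e\<leftarrow>l. A i e))) \<or>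
    (\<exists>(y :: 'i \<Rightarrow> nat) (h :: 'v \<Rightarrow> nat).
      (\<forall>e\<in>E. (\<Sum>i\<in>I. int (y i) * A i e) + int (h (src e)) \<le> int (h (tgt e))) \<and>
      (\<exists>e\<in>E. (\<Sum>i\<in>I. int (y i) * A i e) + int (h (src e)) < int (h (tgt e))))"
proof -
  define W where "W = src ` E \<union> tgt ` E"
  define R where "R = Inl ` I \<union> Inr ` W"
  \<comment> \<open>One row per quantity \<open>i\<close>, and one per node for the excess of
    outgoing over incoming edges.\<close>
  define A' where "A' r e = (case r of Inl i \<Rightarrow> A i e | Inr v \<Rightarrow> of_bool (src e = v) - of_bool (tgt e = v))"
    for r e
  have fin: "finite W" "finite R" using assms by (auto simp: W_def R_def)
  have split: "(\<Sum>r\<in>R. f r) = (\<Sum>i\<in>I. f (Inl i)) + (\<Sum>v\<in>W. f (Inr v))" for f :: "'i + 'v \<Rightarrow> int"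
    unfolding R_def using assms fin
    by (subst sum.union_disjoint) (auto simp: sum.reindex)
  from tucker[OF fin(2) assms(1), of A'] show ?thesis
  proof
    assume "\<exists>x. (\<forall>e\<in>E. 1 \<le> x e) \<and> (\<forall>r\<in>R. 0 \<le> (\<Sum>e\<in>E. A' r e * int (x e)))"
    then obtain x where x: "\<And>e. e \<in> E \<Longrightarrow> 1 \<le> x e" "\<And>r. r \<in> R \<Longrightarrow> 0 \<le> (\<Sum>e\<in>E. A' r e * int (x e))"
      by blast
    obtain u p where p: "walk u p u" "set p = E" using closed_walk_cover assms by blast
    define n where "n = length p"
    \<comment> \<open>The factor \<open>n\<close> makes every edge of \<open>E\<close> occur in
      \<open>z\<close> at least as often as in the covering walk \<open>p\<close>, which can
      therefore be taken out of \<open>z\<close>.\<close>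
    define z where "z = (\<Sum>e\<in>E. replicate_mset (n * x e) e)"
    have cz: "count z e = (if e \<in> E then n * x e else 0)" for e
      using assms(1) by (auto simp: z_def count_sum if_distrib cong: if_cong)
    have sum_z: "(\<Sum>e\<in>#z. g e) = (\<Sum>e\<in>E. int n * (g e * int (x e)))" for g :: "'e \<Rightarrow> int"
      unfolding z_def using assms(1) by (induction E) (auto simp: algebra_simps)
    have "mset p \<subseteq># z"
    proof (rule mset_subset_eqI)
      fix e
      show "count (mset p) e \<le> count z e"
      proof (cases "e \<in> E")
        case True
        have "count (mset p) e \<le> n" unfolding n_def by (metis count_le_size size_mset)
        also have "n \<le> n * x e" using x(1)[OF True] by simp
        finally show ?thesis using True by (simp add: cz)
      next
        case False
        then have "count (mset p) e = 0" using p(2) by (metis count_eq_zero_iff set_mset_mset)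
        then show ?thesis by (rule ord_eq_le_trans) simp
      qed
    qed
    then obtain y where y: "z = mset p + y" by (metis mset_subset_eq_exists_conv)
    have Ez: "set_mset z \<subseteq> E" using cz by (metis count_eq_zero_iff subsetI)
    have deg: "indeg z v \<le> outdeg z v" for v
    proof (cases "v \<in> W")
      case True
      have "int (outdeg z v) - int (indeg z v) = (\<Sum>e\<in>#z. A' (Inr v) e)"
        unfolding outdeg_def indeg_def A'_def by (induction z) auto
      also have "\<dots> = int n * (\<Sum>e\<in>E. A' (Inr v) e * int (x e))"
        by (simp add: sum_z sum_distrib_left)
      also have "\<dots> \<ge> 0" using x(2)[of "Inr v"] True by (simp add: R_def)
      finally show ?thesis by simp
    next
      case False
      then have "\<forall>e\<in>#z. tgt e \<noteq> v" using Ez by (auto simp: W_def)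
      then have "indeg z v = 0" by (auto simp: indeg_def)
      then show ?thesis by simp
    qed
    have "indeg y v \<le> outdeg y v" for v
      using deg[of v] walk_degrees[OF p(1), of v] by (simp add: y degrees_add)
    moreover have "set_mset y \<subseteq> set p" using Ez p by (auto simp: y)
    ultimately obtain l where l: "walk u l u" "mset l = z"
      using closed_walk_extend[OF p(1)] y by metis
    have "p \<noteq> []" using p assms by auto
    then have "l \<noteq> []" using l(2) y by auto
    moreover have "set l \<subseteq> E" using Ez l(2) by auto
    moreover have "0 \<le> (\<Sum>e\<leftarrow>l. A i e)" if "i \<in> I" for i
    proof -
      have "(\<Sum>e\<leftarrow>l. A i e) = (\<Sum>e\<in>#z. A i e)" using sum_mset_sum_list[of "map (A i) l"] by (simp flip: l(2))
      also have "\<dots> = int n * (\<Sum>e\<in>E. A' (Inl i) e * int (x e))"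
        by (simp add: sum_z sum_distrib_left A'_def)
      also have "\<dots> \<ge> 0" using x(2)[of "Inl i"] that by (simp add: R_def)
      finally show ?thesis .
    qed
    ultimately show ?thesis using l(1) by blast
  next
    assume "\<exists>y :: 'i + 'v \<Rightarrow> nat. (\<forall>e\<in>E. (\<Sum>r\<in>R. int (y r) * A' r e) \<le> 0) \<and>
      (\<exists>e\<in>E. (\<Sum>r\<in>R. int (y r) * A' r e) < 0)"
    then obtain y :: "'i + 'v \<Rightarrow> nat" where y: "\<forall>e\<in>E. (\<Sum>r\<in>R. int (y r) * A' r e) \<le> 0"
      "\<exists>e\<in>E. (\<Sum>r\<in>R. int (y r) * A' r e) < 0" by blast
    have *: "(\<Sum>r\<in>R. int (y r) * A' r e) =
        (\<Sum>i\<in>I. int (y (Inl i)) * A i e) + int (y (Inr (src e))) - int (y (Inr (tgt e)))"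
      if "e \<in> E" for e
    proof -
      \<comment> \<open>In the column of \<open>e\<close> only the rows of its two ends survive, so
        the multipliers of the node rows act as a potential.\<close>
      have "(\<Sum>v\<in>W. int (y (Inr v)) * A' (Inr v) e) =
          (\<Sum>v\<in>W. if src e = v then int (y (Inr v)) else 0) - (\<Sum>v\<in>W. if tgt e = v then int (y (Inr v)) else 0)"
        unfolding sum_subtractf[symmetric] by (intro sum.cong) (auto simp: A'_def)
      also have "\<dots> = int (y (Inr (src e))) - int (y (Inr (tgt e)))"
        using that fin by (simp add: W_def)
      finally show ?thesis by (simp add: split A'_def)
    qed
    show ?thesis
      by (rule disjI2, intro exI[of _ "\<lambda>i. y (Inl i)"] exI[of _ "\<lambda>v. y (Inr v)"])
        (use y * in fastforce)
  qed
qed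

end

section \<open>Certificates\<close>

definition region :: "'s set \<Rightarrow> 's \<Rightarrow> ('s \<Rightarrow> nat) \<Rightarrow> bool" where
  "region V p m \<longleftrightarrow> (\<exists>q\<in>V. m q \<ge> 1) \<and> m p \<ge> 1"

lemma region_mono:
  assumes "region V p u" "\<And>q. q \<in> insert p V \<Longrightarrow> u q \<ge> 1 \<Longrightarrow> v q \<ge> 1"
  shows "region V p v"
  using assms unfolding region_def by blast

lemma fires_add:
  assumes "fires N m n" shows "fires N (m + d) (n + d)"
proof -
  obtain a b where ab: "(a, b) \<in> transitions N" "a \<subseteq># m" "n = m - a + b"
    using assms unfolding fires_def by blast
  then obtain c where "m = a + c" by (metis mset_subset_eq_exists_conv)
  then show ?thesis using ab unfolding fires_def
    by (intro bexI[of _ "(a, b)"]) (auto simp: add_ac)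
qed

lemma fires_places:
  assumes "petri_net N" "fires N m n" "set_mset m \<subseteq> places N"
  shows "set_mset n \<subseteq> places N"
proof -
  obtain a b where ab: "(a, b) \<in> transitions N" "n = m - a + b"
    using assms unfolding fires_def by blast
  then have "set_mset b \<subseteq> places N" using assms(1) unfolding petri_net_def by blast
  then show ?thesis using assms(3) ab by (auto dest: in_diffD)
qed

lemma chain_rtranclp:
  assumes "i \<le> j" "\<And>k. i \<le> k \<Longrightarrow> R (f k) (f (Suc k))"
  shows "R\<^sup>*\<^sup>* (f i) (f j)"
  using assms by (induction rule: dec_induct) (auto intro: rtranclp.rtrancl_into_rtrancl)

section \<open>Infinite visits and self-covering loops\<close>

locale petri_instance =
  fixes N :: "'s petri_net" and V :: "'s set" and p :: 's
  assumes net: "petri_net N" and V: "V \<subseteq> places N" and p: "p \<in> places N"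
begin

definition rfires :: "'s multiset \<Rightarrow> 's multiset \<Rightarrow> bool" where
  "rfires m n \<longleftrightarrow> fires N m n \<and> region V p (count m)"

lemma finite_places: "finite (places N)" and finite_transitions: "finite (transitions N)"
  using net by (auto simp: petri_net_def)

lemma transition_places:
  "(a, b) \<in> transitions N \<Longrightarrow> q \<notin> places N \<Longrightarrow> count a q = 0 \<and> count b q = 0"
  using net unfolding petri_net_def by (fastforce simp: count_eq_zero_iff)

lemma reachable_places:
  assumes "(fires N)\<^sup>*\<^sup>* (initial N) m" "q \<notin> places N"
  shows "count m q = 0"
proof -
  have "set_mset m \<subseteq> places N"
    using assms(1)
  proof induction
    case base
    show ?case using net by (simp add: petri_net_def)
  qed (rule fires_places[OF net])
  then show ?thesis using assms(2) by (meson count_eq_zero_iff subsetD)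
qed

lemma rfires_add:
  assumes "rfires m n" shows "rfires (m + d) (n + d)"
proof -
  have "region V p (count m)" using assms by (simp add: rfires_def)
  then have "region V p (count (m + d))" by (rule region_mono) (simp only: count_union trans_le_add1)
  then show ?thesis using assms fires_add by (auto simp: rfires_def)
qed

lemma rfires_rtranclp_add:
  assumes "rfires\<^sup>*\<^sup>* m n" shows "rfires\<^sup>*\<^sup>* (m + d) (n + d)"
  using assms by induction (auto intro: rtranclp.rtrancl_into_rtrancl rfires_add)

text \<open>The invariant \<open>G\<close> says that a marking above \<open>m\<close> is still
  ahead. Each marking in \<open>G\<close> has a successor in \<open>G\<close>: either the path to
  that marking goes on, or the current marking is \<open>m + d\<close> and monotonicity lets the
  loop start again. Dependent choice then yields the infinite run.\<close>

lemma infinitely_visits_of_loop: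
  assumes "(fires N)\<^sup>*\<^sup>* (initial N) m" "rfires m m1" "rfires\<^sup>*\<^sup>* m1 n" "m \<subseteq># n"
  shows "infinitely_visits N V p"
proof -
  define G where "G x \<longleftrightarrow> (\<exists>y. rfires\<^sup>*\<^sup>* x y \<and> m \<subseteq># y)" for x
  have step: "\<exists>y. G y \<and> rfires x y" if "G x" for x
  proof -
    from that obtain y where y: "rfires\<^sup>*\<^sup>* x y" "m \<subseteq># y" by (auto simp: G_def)
    from y(1) show ?thesis
    proof (cases rule: converse_rtranclpE)
      case base
      then obtain d where d: "x = m + d" using y(2) by (metis mset_subset_eq_exists_conv)
      have "m \<subseteq># n + d" using assms(4) by (metis mset_subset_eq_add_left subset_mset.order_trans)
      then have "G (m1 + d)" unfolding G_def using rfires_rtranclp_add[OF assms(3)] by blast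
      then show ?thesis using rfires_add[OF assms(2)] d by blast
    next
      case (step z)
      then show ?thesis using y(2) unfolding G_def by blast
    qed
  qed
  have "\<exists>f. \<forall>n. (G (f n) \<and> (n = 0 \<longrightarrow> f n = m)) \<and> rfires (f n) (f (Suc n))"
  proof (rule dependent_nat_choice)
    show "\<exists>x. G x \<and> ((0::nat) = 0 \<longrightarrow> x = m)" unfolding G_def by auto
  qed (use step in blast)
  then obtain f where f: "f 0 = m" "\<And>n. rfires (f n) (f (Suc n))" by blast
  \<comment> \<open>The path from the initial marking to \<open>m\<close> is put in front step by
    step, each time shifting the index \<open>i\<close> by one.\<close>
  have "\<exists>f i. f 0 = initial N \<and> (\<forall>j. fires N (f j) (f (Suc j))) \<and> (\<forall>j\<ge>i. region V p (count (f j)))"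
    using assms(1)
  proof (induction rule: converse_rtranclp_induct)
    case base
    show ?case by (rule exI[of _ f], rule exI[of _ 0]) (use f in \<open>simp add: rfires_def\<close>)
  next
    case (step y z)
    then obtain f i where f: "f 0 = z" "\<forall>j. fires N (f j) (f (Suc j))" "\<forall>j\<ge>i. region V p (count (f j))"
      by blast
    have "fires N (case_nat y f j) (case_nat y f (Suc j))" for j
      using step f by (cases j) auto
    moreover have "region V p (count (case_nat y f j))" if "j \<ge> Suc i" for j
      using that f by (cases j) auto
    ultimately show ?case by (intro exI[of _ "case_nat y f"] exI[of _ "Suc i"]) simp
  qed
  then show ?thesis unfolding infinitely_visits_def region_def by blast
qed

text \<open>Dickson's lemma gives two comparable markings in the tail of the run; off the places
  both are zero, so they are comparable as multisets. The right side quantifies over finite objects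
  only, which makes the property semidecidable.\<close>

lemma infinitely_visits_iff_loop:
  "infinitely_visits N V p \<longleftrightarrow> (\<exists>m m1 n. (fires N)\<^sup>*\<^sup>* (initial N) m \<and> rfires m m1 \<and> rfires\<^sup>*\<^sup>* m1 n \<and> m \<subseteq># n)"
proof
  assume "infinitely_visits N V p"
  then obtain f i where f: "f 0 = initial N" "\<And>j. fires N (f j) (f (Suc j))"
      "\<And>j. j \<ge> i \<Longrightarrow> region V p (count (f j))"
    unfolding infinitely_visits_def region_def by blast
  obtain r :: "nat \<Rightarrow> nat" where r: "strict_mono r" "\<forall>q\<in>places N. mono (\<lambda>n. count (f (r n + i)) q)"
    using dickson_subseq[OF finite_places, of "\<lambda>n. count (f (n + i))"] by blast
  have reach: "(fires N)\<^sup>*\<^sup>* (initial N) (f j)" for j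
    using chain_rtranclp[of 0 j "fires N" f] f by simp
  have rf: "rfires (f j) (f (Suc j))" if "j \<ge> i" for j
    using f that by (simp add: rfires_def)
  have "r 0 < r 1" using r(1) by (simp add: strict_mono_def)
  then have "rfires\<^sup>*\<^sup>* (f (Suc (r 0 + i))) (f (r 1 + i))"
    using rf by (intro chain_rtranclp) auto
  moreover have "f (r 0 + i) \<subseteq># f (r 1 + i)"
  proof (rule mset_subset_eqI)
    fix q
    show "count (f (r 0 + i)) q \<le> count (f (r 1 + i)) q"
      using r(2) reachable_places[OF reach] by (cases "q \<in> places N") (auto simp: mono_def)
  qed
  moreover have "rfires (f (r 0 + i)) (f (Suc (r 0 + i)))" using rf by simp
  ultimately show "\<exists>m m1 n. (fires N)\<^sup>*\<^sup>* (initial N) m \<and> rfires m m1 \<and> rfires\<^sup>*\<^sup>* m1 n \<and> m \<subseteq># n"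
    using reach by blast
qed (use infinitely_visits_of_loop in blast)

end

section \<open>Certificates that exclude infinite visits\<close>

locale abstraction = petri_instance N V p
  for N :: "'s petri_net" and V :: "'s set" and p :: 's +
  fixes src tgt :: "'e \<Rightarrow> 'v" and pre post :: "'e \<Rightarrow> 's multiset" and val :: "'v \<Rightarrow> 's \<Rightarrow> nat"
begin

definition enabled :: "nat \<Rightarrow> ('s \<Rightarrow> nat) \<Rightarrow> 's multiset \<Rightarrow> bool" where
  "enabled B v a \<longleftrightarrow> (\<forall>q\<in>places N. count a q \<le> v q \<or> B \<le> v q)"

definition succ :: "nat \<Rightarrow> ('s \<Rightarrow> nat) \<Rightarrow> 's multiset \<Rightarrow> 's multiset \<Rightarrow> ('s \<Rightarrow> nat) \<Rightarrow> bool" where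
  "succ B v a b v' \<longleftrightarrow>
     (\<forall>q\<in>places N. v' q = (if B \<le> v q then B else min B (v q - count a q + count b q)))"

text \<open>Rearranged to avoid subtraction: the weighted effect of \<open>e\<close> is at most
  \<open>h (tgt e) - h (src e)\<close>, strictly less for some edge.\<close>

definition ranked :: "'e set \<Rightarrow> bool" where
  "ranked E \<longleftrightarrow> (\<exists>y h.
     (\<forall>e\<in>E. (\<Sum>q\<in>places N. y q * count (post e) q) + h (src e) \<le>
            (\<Sum>q\<in>places N. y q * count (pre e) q) + (h (tgt e) :: nat)) \<and>
     (\<exists>e\<in>E. (\<Sum>q\<in>places N. y q * count (post e) q) + h (src e) <
            (\<Sum>q\<in>places N. y q * count (pre e) q) + h (tgt e)))"

text \<open>The first two conditions let every run be followed in the graph. The third treats each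
  edge set \<open>F\<close> that a closed walk may use on its own, so weights and potential may
  depend on \<open>F\<close>.\<close>

definition certificate :: "nat \<Rightarrow> 'v set \<Rightarrow> 'e set \<Rightarrow> bool" where
  "certificate B W E \<longleftrightarrow>
     (\<exists>w\<in>W. \<forall>q\<in>places N. val w q = min B (count (initial N) q)) \<and>
     (\<forall>w\<in>W. \<forall>(a, b)\<in>transitions N. enabled B (val w) a \<longrightarrow>
        (\<exists>e\<in>E. src e = w \<and> pre e = a \<and> post e = b \<and> tgt e \<in> W \<and> succ B (val w) a b (val (tgt e)))) \<and>
     (\<forall>F\<subseteq>E. F \<noteq> {} \<longrightarrow> (\<exists>e\<in>F. \<not> region V p (val (src e))) \<or> splits src tgt F \<or> ranked F)"

definition below :: "nat \<Rightarrow> 's multiset \<Rightarrow> ('s \<Rightarrow> nat) \<Rightarrow> bool" where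
  "below B m v \<longleftrightarrow> (\<forall>q\<in>places N. count m q \<le> v q \<or> B \<le> v q)"

lemma below_succ:
  assumes "below B m v" "a \<subseteq># m" "succ B v a b v'"
  shows "below B (m - a + b) v'"
  unfolding below_def
proof
  fix q assume q: "q \<in> places N"
  have "count a q \<le> count m q" using assms(2) by (rule mset_subset_eq_count)
  then show "count (m - a + b) q \<le> v' q \<or> B \<le> v' q"
    using assms(1,3) q by (auto simp: below_def succ_def)
qed

text \<open>The run is followed by an infinite walk in the graph. Some node of the finite
  \<open>W\<close> recurs infinitely often, and Dickson's lemma selects two such times
  \<open>i < j\<close> whose markings are comparable. The edges \<open>F\<close> used in between
  violate all three alternatives of the certificate.\<close>

lemma certificate_sound:
  assumes fin: "finite W" and B: "1 \<le> B" and cert: "certificate B W E"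
  shows "\<not> infinitely_visits N V p"
proof
  assume "infinitely_visits N V p"
  then obtain f i0 where f: "f 0 = initial N" "\<And>j. fires N (f j) (f (Suc j))"
      "\<And>j. j \<ge> i0 \<Longrightarrow> region V p (count (f j))"
    unfolding infinitely_visits_def region_def by blast
  \<comment> \<open>\<open>P n e\<close>: the edge \<open>e\<close> follows step \<open>n\<close> of
    the run, and its source bounds the current marking.\<close>
  define P where "P n e \<longleftrightarrow> e \<in> E \<and> src e \<in> W \<and> tgt e \<in> W \<and> below B (f n) (val (src e)) \<and>
    pre e \<subseteq># f n \<and> f (Suc n) = f n - pre e + post e \<and>
    succ B (val (src e)) (pre e) (post e) (val (tgt e))" for n e
  have edge: "\<exists>e. P n e \<and> src e = w" if w: "w \<in> W" "below B (f n) (val w)" for n w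
  proof -
    obtain a b where ab: "(a, b) \<in> transitions N" "a \<subseteq># f n" "f (Suc n) = f n - a + b"
      using f(2)[of n] unfolding fires_def by blast
    have "enabled B (val w) a"
      using w(2) mset_subset_eq_count[OF ab(2)] unfolding below_def enabled_def
      by (meson order_trans)
    moreover have "\<forall>w\<in>W. \<forall>(a, b)\<in>transitions N. enabled B (val w) a \<longrightarrow>
        (\<exists>e\<in>E. src e = w \<and> pre e = a \<and> post e = b \<and> tgt e \<in> W \<and> succ B (val w) a b (val (tgt e)))"
      using cert unfolding certificate_def by (elim conjE)
    ultimately obtain e where "e \<in> E" "src e = w" "pre e = a" "post e = b" "tgt e \<in> W"
      "succ B (val w) a b (val (tgt e))" using ab(1) w(1) by fast
    then show ?thesis using ab w by (intro exI[of _ e]) (simp add: P_def)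
  qed
  have "\<exists>e. \<forall>n. P n (e n) \<and> src (e (Suc n)) = tgt (e n)"
  proof (rule dependent_nat_choice)
    obtain w where w: "w \<in> W" "\<forall>q\<in>places N. val w q = min B (count (initial N) q)"
      using cert unfolding certificate_def by blast
    then have "below B (f 0) (val w)" by (auto simp: below_def f)
    then show "\<exists>e. P 0 e" using edge w by blast
  next
    fix n e assume "P n e"
    then have "tgt e \<in> W" "below B (f (Suc n)) (val (tgt e))"
      using below_succ by (auto simp: P_def)
    then show "\<exists>e'. P (Suc n) e' \<and> src e' = tgt e" using edge by blast
  qed
  then obtain e where e: "\<And>n. P n (e n)" "\<And>n. src (e (Suc n)) = tgt (e n)" by blast
  have "finite ((\<lambda>n. src (e n)) ` {i0..})"
    using e(1) by (intro finite_subset[OF _ fin]) (auto simp: P_def)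
  from pigeonhole_infinite[OF infinite_Ici this] obtain k where
    k: "infinite {n\<in>{i0..}. src (e n) = src (e k)}" by blast
  from infinite_enumerate[OF this] obtain r :: "nat \<Rightarrow> nat" where
    r: "strict_mono r" "\<And>n. r n \<ge> i0" "\<And>n. src (e (r n)) = src (e k)" by auto
  obtain s :: "nat \<Rightarrow> nat" where s: "strict_mono s" "\<forall>q\<in>places N. mono (\<lambda>n. count (f (r (s n))) q)"
    using dickson_subseq[OF finite_places, of "\<lambda>n. count (f (r n))"] by blast
  define i j where "i = r (s 0)" and "j = r (s 1)"
  have ij: "i < j" using r(1) s(1) by (simp add: strict_mono_def i_def j_def)
  have loop: "src (e i) = src (e j)" by (simp add: i_def j_def r)
  have le: "count (f i) q \<le> count (f j) q" if "q \<in> places N" for q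
    using s(2) that by (auto simp: mono_def i_def j_def)
  define F where "F = e ` {i..<j}"
  have "F \<subseteq> E" "F \<noteq> {}" using e(1) ij by (auto simp: F_def P_def)
  moreover have "region V p (val (src (e n)))" if "n \<in> {i..<j}" for n
  proof (rule region_mono[OF f(3)])
    show "i0 \<le> n" using that r(2)[of "s 0"] by (simp add: i_def)
    fix q assume q: "q \<in> insert p V" "1 \<le> count (f n) q"
    then have "q \<in> places N" using V p by blast
    then have "count (f n) q \<le> val (src (e n)) q \<or> B \<le> val (src (e n)) q"
      using e(1)[of n] by (simp add: P_def below_def)
    then show "1 \<le> val (src (e n)) q" using q(2) B by linarith
  qed
  then have "\<not> (\<exists>e\<in>F. \<not> region V p (val (src e)))" by (auto simp: F_def)
  moreover have "\<not> splits src tgt F"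
  proof
    assume "splits src tgt F"
    then obtain X a b where X: "a \<in> {i..<j}" "tgt (e a) \<in> X" "b \<in> {i..<j}" "src (e b) \<notin> X"
      "\<And>n. n \<in> {i..<j} \<Longrightarrow> src (e n) \<in> X \<Longrightarrow> tgt (e n) \<in> X"
      unfolding splits_def F_def by blast
    \<comment> \<open>Once inside \<open>X\<close> the walk stays there. As it returns at time
      \<open>j\<close> to the node of time \<open>i\<close>, it is inside \<open>X\<close> at every
      time in between.\<close>
    have fwd: "src (e n) \<in> X" if "i \<le> n0" "n0 \<le> n" "src (e n0) \<in> X" "n \<le> j" for n0 n
      using that(2,3,4) by (induction rule: dec_induct) (use X(5) e(2) that(1) in auto)
    have "src (e j) \<in> X" using fwd[of "Suc a" j] X e(2)[of a] by auto
    then have "src (e b) \<in> X" using fwd[of i b] loop X by auto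
    with X show False by blast
  qed
  moreover have "\<not> ranked F"
  proof
    assume "ranked F"
    then obtain y and h :: "'v \<Rightarrow> nat" where
      yh: "\<And>n. n \<in> {i..<j} \<Longrightarrow> (\<Sum>q\<in>places N. y q * count (post (e n)) q) + h (src (e n)) \<le>
            (\<Sum>q\<in>places N. y q * count (pre (e n)) q) + h (tgt (e n))"
      "\<exists>n\<in>{i..<j}. (\<Sum>q\<in>places N. y q * count (post (e n)) q) + h (src (e n)) <
            (\<Sum>q\<in>places N. y q * count (pre (e n)) q) + h (tgt (e n))"
      unfolding ranked_def F_def by blast
    \<comment> \<open>This quantity never increases from \<open>i\<close> to \<open>j\<close> and
      drops at least once. But the nodes at \<open>i\<close> and \<open>j\<close> agree and no place
      has lost tokens, so it cannot be smaller at \<open>j\<close>.\<close>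
    define \<phi> where "\<phi> n = int (\<Sum>q\<in>places N. y q * count (f n) q) - int (h (src (e n)))" for n
    have diff: "\<phi> (Suc n) - \<phi> n =
        int ((\<Sum>q\<in>places N. y q * count (post (e n)) q) + h (src (e n))) -
        int ((\<Sum>q\<in>places N. y q * count (pre (e n)) q) + h (tgt (e n)))" for n
    proof -
      have "count (f (Suc n)) q + count (pre (e n)) q = count (f n) q + count (post (e n)) q" for q
        using e(1)[of n] mset_subset_eq_count[of "pre (e n)" "f n" q] by (auto simp: P_def)
      then have "(\<Sum>q\<in>places N. y q * count (f (Suc n)) q) + (\<Sum>q\<in>places N. y q * count (pre (e n)) q) =
          (\<Sum>q\<in>places N. y q * count (f n) q) + (\<Sum>q\<in>places N. y q * count (post (e n)) q)"
        by (simp flip: sum.distrib distrib_left)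
      then show ?thesis unfolding \<phi>_def e(2) by linarith
    qed
    have mono: "\<phi> n \<le> \<phi> n0" if "i \<le> n0" "n0 \<le> n" "n \<le> j" for n0 n
      using that(2,3)
    proof (induction rule: dec_induct)
      case (step n)
      then have "\<phi> n \<le> \<phi> n0" "n \<in> {i..<j}" using \<open>i \<le> n0\<close> by auto
      then show ?case using yh(1)[of n] diff[of n] by linarith
    qed simp
    obtain n where n: "n \<in> {i..<j}" "\<phi> (Suc n) < \<phi> n"
    proof -
      obtain n where n: "n \<in> {i..<j}" "(\<Sum>q\<in>places N. y q * count (post (e n)) q) + h (src (e n)) <
            (\<Sum>q\<in>places N. y q * count (pre (e n)) q) + h (tgt (e n))" using yh(2) by blast
      then have "\<phi> (Suc n) < \<phi> n" using diff[of n] by linarith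
      with n(1) show ?thesis using that by blast
    qed
    have "\<phi> j < \<phi> i" using mono[of i n] mono[of "Suc n" j] n by auto
    moreover have "\<phi> i \<le> \<phi> j"
      using le by (auto simp: \<phi>_def loop intro!: sum_mono mult_left_mono)
    ultimately show False by simp
  qed
  ultimately show False using cert unfolding certificate_def by blast
qed

text \<open>Since no edge creates an omega, \<open>succ\<close> truncates nothing on the other
  places, where the node values stay lower bounds for the marking. On the omega places
  \<open>m\<close> holds the total consumption of the walk in reserve; the additional
  \<open>B\<close> tokens keep these places marked, as \<open>region\<close> may demand.\<close>

lemma run_along_walk:
  assumes B: "1 \<le> B" and "walk src tgt u l v"
    and "\<And>e. e \<in> set l \<Longrightarrow> (pre e, post e) \<in> transitions N \<and> region V p (val (src e)) \<and>
      enabled B (val (src e)) (pre e) \<and> succ B (val (src e)) (pre e) (post e) (val (tgt e))"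
    and "\<And>e q. e \<in> set l \<Longrightarrow> q \<in> places N \<Longrightarrow> B \<le> val (tgt e) q \<Longrightarrow> B \<le> val (src e) q"
    and "\<And>q. q \<in> places N \<Longrightarrow>
      (if B \<le> val u q then B + (\<Sum>e\<leftarrow>l. count (pre e) q) else val u q) \<le> count m q"
  shows "\<exists>n. (rfires ^^ length l) m n \<and>
    (\<forall>q. int (count n q) = int (count m q) + (\<Sum>e\<leftarrow>l. int (count (post e) q) - int (count (pre e) q)))"
  using assms(2-)
proof (induction l arbitrary: u m)
  case Nil
  then show ?case by auto
next
  case (Cons e l)
  let ?m = "m - pre e + post e"
  have e: "src e = u" "walk src tgt (tgt e) l v" "(pre e, post e) \<in> transitions N"
    "region V p (val u)" "enabled B (val u) (pre e)" "succ B (val u) (pre e) (post e) (val (tgt e))"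
    using Cons.prems(1) Cons.prems(2)[of e] by auto
  have m: "(if B \<le> val u q then B + count (pre e) q + (\<Sum>e\<leftarrow>l. count (pre e) q) else val u q) \<le> count m q"
    if "q \<in> places N" for q using Cons.prems(4)[OF that] by (simp split: if_splits)
  have pre: "count (pre e) q \<le> count m q" for q
  proof (cases "q \<in> places N")
    case True
    then have "count (pre e) q \<le> val u q \<or> B \<le> val u q" using e(5) by (simp add: enabled_def)
    then show ?thesis using m[OF True] by (auto split: if_splits)
  next
    case False
    then show ?thesis using transition_places[OF e(3)] by simp
  qed
  then have sub: "pre e \<subseteq># m" by (rule mset_subset_eqI)
  have "region V p (count m)"
  proof (rule region_mono[OF e(4)])
    fix q assume q: "q \<in> insert p V" "1 \<le> val u q"
    then have "q \<in> places N" using V p by blast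
    from m[OF this] have "val u q \<le> count m q \<or> B \<le> count m q" by (simp split: if_splits)
    then show "1 \<le> count m q" using q(2) B by linarith
  qed
  then have "rfires m ?m" using e(3) sub by (auto simp: rfires_def fires_def)
  moreover have "(if B \<le> val (tgt e) q then B + (\<Sum>e\<leftarrow>l. count (pre e) q) else val (tgt e) q) \<le> count ?m q"
    if q: "q \<in> places N" for q
  proof -
    have "B \<le> val (tgt e) q \<longrightarrow> B \<le> val u q" using Cons.prems(3)[of e q] q e(1) by auto
    then show ?thesis using m[OF q] pre[of q] e(6) q by (auto simp: succ_def)
  qed
  then obtain n where "(rfires ^^ length l) ?m n" "\<forall>q. int (count n q) = int (count ?m q) +
      (\<Sum>e\<leftarrow>l. int (count (post e) q) - int (count (pre e) q))"
    using Cons.IH[OF e(2), of ?m] Cons.prems by auto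
  moreover have "int (count ?m q) = int (count m q) + (int (count (post e) q) - int (count (pre e) q))" for q
    using pre[of q] by simp
  ultimately show ?case
    by (intro exI[of _ n]) (simp add: relpowp_Suc_I2 del: relpowp.simps)
qed

text \<open>The nodes represent the truncated valuations covered by reachable markings, for a
  \<open>B\<close> at which truncation loses nothing. A set \<open>F\<close> violating the third
  condition would give a closed walk of nonnegative effect that the net can really perform, hence an
  infinite visit.\<close>

lemma certificate_complete:
  assumes not: "\<not> infinitely_visits N V p"
    and ex_val: "\<And>v. \<exists>w. \<forall>q\<in>places N. val w q = v q"
    and ex_edge: "\<And>w a b w'. (a, b) \<in> transitions N \<Longrightarrow>
      \<exists>e. src e = w \<and> pre e = a \<and> post e = b \<and> tgt e = w'"
  shows "\<exists>B\<ge>1. \<exists>W E. finite W \<and> finite E \<and> certificate B W E"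
proof -
  let ?S = "places N"
  define D where "D u \<longleftrightarrow> (\<exists>m. (fires N)\<^sup>*\<^sup>* (initial N) m \<and> (\<forall>q\<in>?S. u q \<le> count m q))" for u
  have down: "D u" if "D v" "\<And>q. q \<in> ?S \<Longrightarrow> u q \<le> v q" for u v
    using that unfolding D_def by (meson order_trans)
  obtain B where B: "1 \<le> B" "\<And>u. D (\<lambda>q. min B (u q)) \<Longrightarrow> D u"
    using truncation_bound[OF finite_places, of D] down by blast
  obtain cd where cd: "\<And>v q. q \<in> ?S \<Longrightarrow> val (cd v) q = v q" using ex_val by metis
  have "\<forall>w t w'. \<exists>e. t \<in> transitions N \<longrightarrow> src e = w \<and> pre e = fst t \<and> post e = snd t \<and> tgt e = w'"
    using ex_edge by (metis prod.collapse)
  then obtain ed where ed: "\<And>w t w'. t \<in> transitions N \<Longrightarrow>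
      src (ed w t w') = w \<and> pre (ed w t w') = fst t \<and> post (ed w t w') = snd t \<and> tgt (ed w t w') = w'"
    by metis
  \<comment> \<open>The value 0 off the places makes \<open>U\<close> finite.\<close>
  define U where "U = {v. (\<forall>q\<in>?S. v q \<le> B) \<and> (\<forall>q. q \<notin> ?S \<longrightarrow> v q = 0) \<and> D v}"
  define W where "W = cd ` U"
  define E where "E = (\<lambda>(w, t, w'). ed w t w') `
    {(w, t, w'). w \<in> W \<and> t \<in> transitions N \<and> w' \<in> W \<and> enabled B (val w) (fst t) \<and>
      succ B (val w) (fst t) (snd t) (val w')}"
  have "finite {v. \<forall>q. (q \<in> ?S \<longrightarrow> v q \<in> {..B}) \<and> (q \<notin> ?S \<longrightarrow> v q = 0)}"
    by (rule finite_set_of_finite_funs) (use finite_places in auto)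
  then have "finite U" by (rule rev_finite_subset) (auto simp: U_def)
  then have finW: "finite W" by (simp add: W_def)
  have finE: "finite E" unfolding E_def
    by (intro finite_imageI finite_subset[OF _ finite_SigmaI[OF finW finite_SigmaI[OF finite_transitions finW]]]) auto
  \<comment> \<open>Truncated at \<open>B\<close>, this valuation agrees with that of
    \<open>w\<close> on the places, so the choice of \<open>B\<close> yields \<open>D\<close> for
    every \<open>g\<close>.\<close>
  have lift: "D (\<lambda>q. if B \<le> val w q then B + g q else val w q)" if w: "w \<in> W" for w g
  proof -
    obtain v where v: "w = cd v" "v \<in> U" using w by (auto simp: W_def)
    show ?thesis
      by (rule B(2), rule down[of v]) (use v in \<open>auto simp: U_def cd\<close>)
  qed
  have edgeE: "src e \<in> W \<and> tgt e \<in> W \<and> (pre e, post e) \<in> transitions N \<and>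
      enabled B (val (src e)) (pre e) \<and> succ B (val (src e)) (pre e) (post e) (val (tgt e))"
    if "e \<in> E" for e
    using that by (auto simp: E_def ed)
  have "certificate B W E"
    unfolding certificate_def
  proof (intro conjI ballI allI impI)
    define v where "v q = (if q \<in> ?S then min B (count (initial N) q) else 0)" for q
    have "v \<in> U" by (auto simp: U_def D_def v_def intro!: exI[of _ "initial N"])
    then show "\<exists>w\<in>W. \<forall>q\<in>?S. val w q = min B (count (initial N) q)"
      by (intro bexI[of _ "cd v"]) (auto simp: W_def cd v_def)
  next
    fix w t
    assume w: "w \<in> W" and t: "t \<in> transitions N"
    obtain a b where t_eq: "t = (a, b)" by (cases t)
    with t have ab: "(a, b) \<in> transitions N" by simp
    have "\<exists>e\<in>E. src e = w \<and> pre e = a \<and> post e = b \<and> tgt e \<in> W \<and> succ B (val w) a b (val (tgt e))"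
      if en: "enabled B (val w) a"
    proof -
      \<comment> \<open>The reserve \<open>count a\<close> on the omega places pays for the firing
        and leaves at least \<open>B\<close> tokens there.\<close>
      obtain m where m: "(fires N)\<^sup>*\<^sup>* (initial N) m"
        "\<And>q. q \<in> ?S \<Longrightarrow> (if B \<le> val w q then B + count a q else val w q) \<le> count m q"
        using lift[OF w, of "count a"] unfolding D_def by blast
      have am: "count a q \<le> count m q" for q
        using m(2)[of q] en transition_places[OF ab, of q] unfolding enabled_def
        by (cases "q \<in> ?S") (auto split: if_splits)
      then have "a \<subseteq># m" by (rule mset_subset_eqI)
      then have "fires N m (m - a + b)" using ab by (auto simp: fires_def)
      with m(1) have reach: "(fires N)\<^sup>*\<^sup>* (initial N) (m - a + b)" by simp
      define v where "v q = (if q \<in> ?S then if B \<le> val w q then B else min B (val w q - count a q + count b q) else 0)" for q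
      have "D v" unfolding D_def
      proof (intro exI conjI ballI, rule reach)
        fix q assume "q \<in> ?S"
        then show "v q \<le> count (m - a + b) q" using m(2)[of q] am[of q] by (auto simp: v_def)
      qed
      then have "v \<in> U" by (auto simp: U_def v_def)
      then have W': "cd v \<in> W" by (simp add: W_def)
      have sc: "succ B (val w) a b (val (cd v))" by (simp add: succ_def cd v_def)
      have "ed w (a, b) (cd v) \<in> E" unfolding E_def
        by (rule image_eqI[of _ _ "(w, (a, b), cd v)"]) (use w W' ab en sc in auto)
      then show ?thesis
        using ed[OF ab] W' sc by (intro bexI[of _ "ed w (a, b) (cd v)"]) auto
    qed
    then show "case t of (a, b) \<Rightarrow> enabled B (val w) a \<longrightarrow>
        (\<exists>e\<in>E. src e = w \<and> pre e = a \<and> post e = b \<and> tgt e \<in> W \<and> succ B (val w) a b (val (tgt e)))"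
      by (simp add: t_eq)
  next
    fix F assume F: "F \<subseteq> E" "F \<noteq> {}"
    show "(\<exists>e\<in>F. \<not> region V p (val (src e))) \<or> splits src tgt F \<or> ranked F"
    proof (rule ccontr)
      assume "\<not> ?thesis"
      then have reg: "\<And>e. e \<in> F \<Longrightarrow> region V p (val (src e))"
        and splits: "\<not> splits src tgt F" and ranked: "\<not> ranked F" by blast+
      let ?A = "\<lambda>q e. int (count (post e) q) - int (count (pre e) q)"
      have "finite F" using F finE by (blast intro: finite_subset)
      from nonneg_closed_walk[OF this F(2) finite_places splits, of ?A]
      consider u l where "l \<noteq> []" "walk src tgt u l u" "set l \<subseteq> F" "\<forall>q\<in>?S. 0 \<le> (\<Sum>e\<leftarrow>l. ?A q e)"
        | y h where "\<forall>e\<in>F. (\<Sum>q\<in>?S. int (y q) * ?A q e) + int (h (src e)) \<le> int (h (tgt e))"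
          "\<exists>e\<in>F. (\<Sum>q\<in>?S. int (y q) * ?A q e) + int (h (src e)) < int (h (tgt e))"
        by blast
      then show False
      proof cases
        case 1
        have edge: "src e \<in> W \<and> tgt e \<in> W \<and> (pre e, post e) \<in> transitions N \<and>
            enabled B (val (src e)) (pre e) \<and> succ B (val (src e)) (pre e) (post e) (val (tgt e))"
          if "e \<in> set l" for e
          using that 1(3) F(1) edgeE by blast
        \<comment> \<open>An omega is never lost along a walk. Hence on a closed walk none can be
          gained either, which is \<open>const\<close>.\<close>
        have omega: "B \<le> val v' q"
          if "walk src tgt v k v'" "set k \<subseteq> set l" "q \<in> ?S" "B \<le> val v q" for v k v' q
          using that
        proof (induction k arbitrary: v)
          case (Cons e k)
          then have "B \<le> val (tgt e) q" using edge[of e] by (auto simp: succ_def)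
          then show ?case using Cons.IH[of "tgt e"] Cons.prems by simp
        qed simp
        have const: "B \<le> val (src e) q" if "e \<in> set l" "q \<in> ?S" "B \<le> val (tgt e) q" for e q
        proof -
          obtain k1 k2 where l: "l = k1 @ e # k2" using \<open>e \<in> set l\<close> by (meson split_list)
          then have "walk src tgt u k1 (src e)" "walk src tgt (tgt e) k2 u"
            using 1(2) by (auto simp: walk_append)
          then show ?thesis using omega[of "tgt e" k2 u q] omega[of u k1 "src e" q] that l by auto
        qed
        have "u \<in> W" using 1(1,2) edge by (cases l) auto
        \<comment> \<open>The reserve is the consumption of the entire closed walk.\<close>
        from lift[OF this, of "\<lambda>q. \<Sum>e\<leftarrow>l. count (pre e) q"] obtain m where
          m: "(fires N)\<^sup>*\<^sup>* (initial N) m" "\<And>q. q \<in> ?S \<Longrightarrow>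
            (if B \<le> val u q then B + (\<Sum>e\<leftarrow>l. count (pre e) q) else val u q) \<le> count m q"
          unfolding D_def by blast
        have "\<exists>n. (rfires ^^ length l) m n \<and> (\<forall>q. int (count n q) = int (count m q) + (\<Sum>e\<leftarrow>l. ?A q e))"
          by (rule run_along_walk[OF B(1) 1(2)]) (use edge const m(2) reg 1(3) in auto)
        then obtain n where n: "(rfires ^^ length l) m n"
          "\<And>q. int (count n q) = int (count m q) + (\<Sum>e\<leftarrow>l. ?A q e)" by blast
        have "m \<subseteq># n"
        proof (rule mset_subset_eqI)
          fix q
          show "count m q \<le> count n q"
          proof (cases "q \<in> ?S")
            case True
            then have "int (count m q) \<le> int (count n q)" using 1(4) by (simp add: n(2))
            then show ?thesis by simp
          next
            case False
            then show ?thesis using reachable_places[OF m(1)] by simp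
          qed
        qed
        obtain k where "length l = Suc k" using 1(1) by (cases l) auto
        then obtain m1 where "rfires m m1" "(rfires ^^ k) m1 n"
          using n(1) by (metis relpowp_Suc_D2)
        then have "infinitely_visits N V p"
          using infinitely_visits_of_loop[OF m(1)] \<open>m \<subseteq># n\<close> by (blast dest: relpowp_imp_rtranclp)
        with not show False by blast
      next
        case 2
        have diff: "(\<Sum>q\<in>?S. int (y q) * ?A q e) =
            int (\<Sum>q\<in>?S. y q * count (post e) q) - int (\<Sum>q\<in>?S. y q * count (pre e) q)" for e
          by (simp add: right_diff_distrib sum_subtractf)
        have "(\<Sum>q\<in>?S. y q * count (post e) q) + h (src e) \<le>
              (\<Sum>q\<in>?S. y q * count (pre e) q) + h (tgt e)" if "e \<in> F" for e
          using bspec[OF 2(1) that] unfolding diff by linarith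
        moreover have "\<exists>e\<in>F. (\<Sum>q\<in>?S. y q * count (post e) q) + h (src e) <
              (\<Sum>q\<in>?S. y q * count (pre e) q) + h (tgt e)"
        proof -
          obtain e where "e \<in> F" and e: "(\<Sum>q\<in>?S. int (y q) * ?A q e) + int (h (src e)) < int (h (tgt e))"
            using 2(2) by blast
          then show ?thesis using e unfolding diff by (intro bexI[of _ e]) linarith+
        qed
        ultimately have "ranked F" unfolding ranked_def by blast
        with ranked show False by blast
      qed
    qed
  qed
  then show ?thesis using B(1) finW finE by blast
qed

end

section \<open>Coding\<close>

lemma recursive_comp1:
  assumes "recursive (\<lambda>e. F (e 0))" "recursive f" shows "recursive (\<lambda>e. F (f e))"
  using recursive_app[of "\<lambda>x _. F x", OF assms] .

lemma dec_comp2: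
  assumes "dec (\<lambda>e. P (e 0) (e 1))" "recursive f" "recursive g" shows "dec (\<lambda>e. P (f e) (g e))"
proof -
  have "recursive (case_nat f (\<lambda>_. g) i)" for i
    by (cases i) (auto simp: assms)
  from dec_subst[OF assms(1), of "case_nat f (\<lambda>_. g)", OF this] show ?thesis by simp
qed

lemma re_app2:
  assumes "re (\<lambda>e. P (e 0) (e 1) (\<lambda>i. e (Suc (Suc i))))" "recursive f" "recursive g"
    and "\<And>i. recursive (s i)"
  shows "re (\<lambda>e. P (f e) (g e) (\<lambda>i. s i e))"
proof -
  have "recursive (case_nat f (case_nat g s) i)" for i
    using assms by (auto split: nat.split)
  from re_subst[OF assms(1), of "case_nat f (case_nat g s)", OF this] show ?thesis by simp
qed

lemmas rec_basic = recursive_var recursive_Suc recursive_add recursive_mult recursive_diff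
  recursive_if dec_not dec_conj dec_disj dec_imp dec_le dec_less dec_eq dec_bex dec_ball recursive_sum
  recursive_const

lemma recursive_min:
  assumes "recursive f" "recursive g" shows "recursive (\<lambda>e. min (f e) (g e))"
  unfolding min_def by (intro rec_basic assms)

lemma recursive_half:
  assumes "recursive f" shows "recursive (\<lambda>e. f e div 2)"
proof (rule recursive_comp1[OF _ assms])
  have "recursive (\<lambda>e. LEAST y. e 0 < 2 * Suc y)"
  proof (rule recursive_Least)
    show "\<exists>y. e 0 < 2 * Suc y" for e :: "nat \<Rightarrow> nat" by presburger
  qed (intro rec_basic)
  moreover have "(LEAST y. x < 2 * Suc y) = x div 2" for x by (rule Least_equality) auto
  ultimately show "recursive (\<lambda>e. e 0 div 2)" by simp
qed

lemma dec_mem_set_decode: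
  assumes "recursive f" "recursive g" shows "dec (\<lambda>e. f e \<in> set_decode (g e))"
proof (rule dec_comp2[OF _ assms])
  \<comment> \<open>Halving \<open>e 1\<close> repeatedly, \<open>e 0\<close> times, moves the bit
    in question to the last position, where parity reads it off.\<close>
  let ?h = "\<lambda>e. rec_nat (e 1) (\<lambda>_ r. r div 2) (e 0)"
  have h: "recursive ?h" by (intro recursive_rec_nat recursive_half rec_basic)
  have eq: "rec_nat x (\<lambda>_ r. r div 2) n = x div 2 ^ n" for x n :: nat
    by (induction n) (auto simp: div_mult2_eq[symmetric] mult.commute)
  have "dec (\<lambda>e. ?h e \<noteq> 2 * (?h e div 2))" by (intro recursive_half rec_basic h)
  moreover have "x \<noteq> 2 * (x div 2) \<longleftrightarrow> odd x" for x :: nat by presburger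
  ultimately show "dec (\<lambda>e. e 0 \<in> set_decode (e 1))" by (simp add: eq set_decode_def)
qed

lemma recursive_prod_encode:
  assumes "recursive f" "recursive g" shows "recursive (\<lambda>e. prod_encode (f e, g e))"
  unfolding prod_encode_def triangle_def prod.case by (intro recursive_half rec_basic assms)

lemma recursive_fst_decode:
  assumes "recursive f" shows "recursive (\<lambda>e. fst (prod_decode (f e)))"
proof (rule recursive_comp1[OF _ assms])
  \<comment> \<open>A component is at most the code of its pair, so the search for the other
    component is bounded.\<close>
  have ex: "\<exists>b<Suc x. prod_encode (fst (prod_decode x), b) = x" for x
    using le_prod_encode_2[of "snd (prod_decode x)" "fst (prod_decode x)"]
    by (intro exI[of _ "snd (prod_decode x)"]) (simp add: less_Suc_eq_le)
  have "recursive (\<lambda>e. LEAST a. \<exists>b<Suc (e 0). prod_encode (a, b) = e 0)"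
  proof (rule recursive_Least)
    show "\<exists>a. \<exists>b<Suc (e 0). prod_encode (a, b) = e 0" for e :: "nat \<Rightarrow> nat" using ex by blast
  qed (intro recursive_prod_encode rec_basic)
  moreover have "(LEAST a. \<exists>b<Suc x. prod_encode (a, b) = x) = fst (prod_decode x)" for x
  proof (rule Least_equality, rule ex)
    fix a assume "\<exists>b<Suc x. prod_encode (a, b) = x"
    then obtain b where "prod_encode (a, b) = x" by blast
    then have "prod_decode x = (a, b)" by (metis prod_encode_inverse)
    then show "fst (prod_decode x) \<le> a" by simp
  qed
  ultimately show "recursive (\<lambda>e. fst (prod_decode (e 0)))" by simp
qed

lemma recursive_snd_decode:
  assumes "recursive f" shows "recursive (\<lambda>e. snd (prod_decode (f e)))"
proof (rule recursive_comp1[OF _ assms])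
  have "recursive (\<lambda>e. LEAST b. prod_encode (fst (prod_decode (e 0)), b) = e 0)"
  proof (rule recursive_Least)
    show "\<exists>b. prod_encode (fst (prod_decode (e 0)), b) = e 0" for e :: "nat \<Rightarrow> nat"
      by (intro exI[of _ "snd (prod_decode (e 0))"]) simp
  qed (intro recursive_prod_encode recursive_fst_decode rec_basic)
  moreover have "(LEAST b. prod_encode (fst (prod_decode x), b) = x) = snd (prod_decode x)" for x
  proof (rule Least_equality)
    fix b assume "prod_encode (fst (prod_decode x), b) = x"
    then have "prod_decode x = (fst (prod_decode x), b)" by (metis prod_encode_inverse)
    then have "snd (prod_decode x) = b" by (metis snd_conv)
    then show "snd (prod_decode x) \<le> b" by simp
  qed simp
  ultimately show "recursive (\<lambda>e. snd (prod_decode (e 0)))" by simp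
qed

text \<open>A nonempty list is coded by the successor of the pair of its head and the code of its
  tail, whence the predecessor. Being total, \<open>nthc x\<close> turns each number
  \<open>x\<close> into a function on the naturals.\<close>

definition nthc :: "nat \<Rightarrow> nat \<Rightarrow> nat" where
  "nthc x n = fst (prod_decode (list_encode (drop n (list_decode x)) - 1))"

lemma nthc_eq: "n < length (list_decode x) \<Longrightarrow> nthc x n = list_decode x ! n"
  by (simp add: nthc_def Cons_nth_drop_Suc[symmetric])

lemma recursive_drop:
  assumes "recursive f" "recursive g"
  shows "recursive (\<lambda>e. list_encode (drop (g e) (list_decode (f e))))"
proof -
  \<comment> \<open>This makes the formula for \<open>tl\<close> correct on the empty list, whose
    code is 0.\<close>
  have "prod_decode 0 = (0, 0)" by (simp add: prod_decode_def prod_decode_aux.simps)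
  then have tl: "list_encode (tl xs) = snd (prod_decode (list_encode xs - 1))" for xs
    by (cases xs) auto
  have "recursive (\<lambda>e. rec_nat (f e) (\<lambda>_ r. snd (prod_decode (r - 1))) (g e))"
    by (intro recursive_rec_nat recursive_snd_decode rec_basic assms)
  moreover have "rec_nat x (\<lambda>_ r. snd (prod_decode (r - 1))) n = list_encode (drop n (list_decode x))" for x n
    by (induction n) (simp_all add: tl[symmetric, simplified] tl_drop drop_Suc)
  ultimately show ?thesis by simp
qed

lemma recursive_nthc:
  assumes "recursive f" "recursive g" shows "recursive (\<lambda>e. nthc (f e) (g e))"
  unfolding nthc_def by (intro recursive_fst_decode recursive_drop rec_basic assms)

lemma recursive_length:
  assumes "recursive f" shows "recursive (\<lambda>e. length (list_decode (f e)))"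
proof (rule recursive_comp1[OF _ assms])
  have 0: "list_encode xs = 0 \<longleftrightarrow> xs = []" for xs by (cases xs) auto
  have "recursive (\<lambda>e. LEAST n. list_encode (drop n (list_decode (e 0))) = 0)"
  proof (rule recursive_Least)
    show "\<exists>n. list_encode (drop n (list_decode (e 0))) = 0" for e :: "nat \<Rightarrow> nat"
      by (auto simp: 0)
  qed (intro recursive_drop rec_basic)
  moreover have "(LEAST n. list_encode (drop n (list_decode x)) = 0) = length (list_decode x)" for x
    by (rule Least_equality) (auto simp: 0)
  ultimately show "recursive (\<lambda>e. length (list_decode (e 0)))" by simp
qed

text \<open>Replaces quantifiers over functions by quantifiers over numbers wherever only finitely
  many arguments matter.\<close>

lemma ex_nthc:
  assumes "finite S" shows "\<exists>c. \<forall>q\<in>S. nthc c q = v q"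
proof -
  obtain n where n: "\<forall>q\<in>S. q < n" using assms finite_nat_set_iff_bounded by auto
  show ?thesis
    by (rule exI[of _ "list_encode (map v [0..<n])"]) (use n in \<open>auto simp: nthc_eq\<close>)
qed

text \<open>A path is stored as one number \<open>c\<close> with its length \<open>n\<close>,
  leaving a bounded quantifier over its steps.\<close>

lemma re_rtranclp:
  assumes "re (\<lambda>e. R (e 0) (e 1) (\<lambda>i. e (Suc (Suc i))))" "recursive f" "recursive g"
  shows "re (\<lambda>e. (\<lambda>x y. R x y e)\<^sup>*\<^sup>* (f e) (g e))"
proof -
  have eq: "(\<lambda>x y. R x y e)\<^sup>*\<^sup>* a b \<longleftrightarrow>
      (\<exists>n c. (nthc c 0 = a \<and> nthc c n = b) \<and> (\<forall>j<n. R (nthc c j) (nthc c (Suc j)) e))" for a b e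
  proof
    assume "(\<lambda>x y. R x y e)\<^sup>*\<^sup>* a b"
    then obtain n h where h: "h 0 = a" "h n = b" "\<forall>j<n. R (h j) (h (Suc j)) e"
      unfolding rtranclp_power relpowp_fun_conv by blast
    obtain c where c: "\<forall>j\<in>{..n}. nthc c j = h j" using ex_nthc[of "{..n}" h] by auto
    show "\<exists>n c. (nthc c 0 = a \<and> nthc c n = b) \<and> (\<forall>j<n. R (nthc c j) (nthc c (Suc j)) e)"
      by (intro exI[of _ n] exI[of _ c]) (use h c in auto)
  next
    assume "\<exists>n c. (nthc c 0 = a \<and> nthc c n = b) \<and> (\<forall>j<n. R (nthc c j) (nthc c (Suc j)) e)"
    then show "(\<lambda>x y. R x y e)\<^sup>*\<^sup>* a b" unfolding rtranclp_power relpowp_fun_conv by blast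
  qed
  have sh: "recursive (\<lambda>e. f (\<lambda>i. e (Suc (Suc i))))" "recursive (\<lambda>e. g (\<lambda>i. e (Suc (Suc i))))"
    using assms(2,3) by (auto intro: recursive_subst recursive_var)
  show ?thesis unfolding eq
    by (intro re_ex re_conj re_ball re_dec[OF dec_conj] re_app2[OF assms(1)] recursive_nthc rec_basic sh)
qed

text \<open>Makes quantifiers and sums over a coded set bounded by its code.\<close>

lemma mem_set_decode_less: "n \<in> set_decode x \<Longrightarrow> n < x"
proof -
  assume "n \<in> set_decode x"
  then have "x div 2 ^ n \<noteq> 0" by (intro notI) (simp add: set_decode_def)
  then have "2 ^ n \<le> x" by (auto simp: div_eq_0_iff)
  then show "n < x" using less_exp[of n] by linarith
qed

lemma dec_ball_set:
  assumes "dec (\<lambda>e. P (e 0) (\<lambda>i. e (Suc i)))" "recursive f"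
  shows "dec (\<lambda>e. \<forall>i\<in>set_decode (f e). P i e)"
proof -
  have "recursive (\<lambda>e. f (\<lambda>i. e (Suc i)))"
    using assms(2) by (rule recursive_subst) (rule recursive_var)
  then have "dec (\<lambda>e. \<forall>i<f e. i \<in> set_decode (f e) \<longrightarrow> P i e)"
    by (intro dec_mem_set_decode rec_basic assms)
  moreover have "(\<forall>i<x. i \<in> set_decode x \<longrightarrow> P i e) \<longleftrightarrow> (\<forall>i\<in>set_decode x. P i e)" for x e
    using mem_set_decode_less by blast
  ultimately show ?thesis by simp
qed

lemma dec_bex_set:
  assumes "dec (\<lambda>e. P (e 0) (\<lambda>i. e (Suc i)))" "recursive f"
  shows "dec (\<lambda>e. \<exists>i\<in>set_decode (f e). P i e)"
  using dec_not[OF dec_ball_set[OF dec_not[OF assms(1)] assms(2)]] by simp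

lemma recursive_sum_set:
  assumes "recursive (\<lambda>e. h (e 0) (\<lambda>i. e (Suc i)))" "recursive f"
  shows "recursive (\<lambda>e. \<Sum>i\<in>set_decode (f e). h i e)"
proof -
  have "recursive (\<lambda>e. f (\<lambda>i. e (Suc i)))"
    using assms(2) by (rule recursive_subst) (rule recursive_var)
  then have "recursive (\<lambda>e. \<Sum>i<f e. if i \<in> set_decode (f e) then h i e else 0)"
    by (intro dec_mem_set_decode rec_basic assms)
  moreover have "(\<Sum>i<x. if i \<in> set_decode x then h i e else 0) = (\<Sum>i\<in>set_decode x. h i e)" for x e
  proof -
    have "{..<x} \<inter> set_decode x = set_decode x" using mem_set_decode_less by blast
    then show ?thesis by (simp add: sum.If_cases)
  qed
  ultimately show ?thesis by simp
qed

section \<open>Coded markings\<close>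

definition marking_decode :: "nat \<Rightarrow> nat multiset" where
  "marking_decode x = mset (list_decode x)"

lemma marking_decode_surj: "\<exists>x. marking_decode x = m"
proof -
  obtain xs where "mset xs = m" by (metis ex_mset)
  then show ?thesis by (intro exI[of _ "list_encode xs"]) (simp add: marking_decode_def)
qed

text \<open>A list code exceeds every entry of the list, so markings can be compared by a bounded
  quantifier over places.\<close>

lemma count_marking_decode_eq_0: "x \<le> q \<Longrightarrow> count (marking_decode x) q = 0"
proof -
  have "q \<in> set xs \<Longrightarrow> q < list_encode xs" for xs
    by (induction xs) (auto simp: less_Suc_eq_le intro: le_prod_encode_1 le_trans[OF less_imp_le le_prod_encode_2])
  from this[of "list_decode x"] show "x \<le> q \<Longrightarrow> count (marking_decode x) q = 0"
    by (auto simp: marking_decode_def count_mset_0_iff)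
qed

lemma recursive_count:
  assumes "recursive f" "recursive g"
  shows "recursive (\<lambda>e. count (marking_decode (f e)) (g e))"
proof (rule recursive_app2[OF _ assms])
  have "recursive (\<lambda>e. \<Sum>i<length (list_decode (e 0)). if nthc (e 0) i = e 1 then 1 else 0)"
    by (intro recursive_length recursive_nthc rec_basic)
  moreover have "(\<Sum>i<length (list_decode x). if nthc x i = q then 1 else 0) = count (marking_decode x) q" for x q
  proof -
    have "(\<Sum>i<length (list_decode x). if nthc x i = q then 1 else 0) =
        (\<Sum>i<length (list_decode x). if list_decode x ! i = q then 1 else 0)"
      by (intro sum.cong) (auto simp: nthc_eq)
    also have "\<dots> = (\<Sum>y\<leftarrow>list_decode x. if y = q then 1 else 0)"
      by (simp add: sum_list_sum_nth atLeast0LessThan)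
    also have "\<dots> = count (mset xs) q" if "xs = list_decode x" for xs
      unfolding that[symmetric] by (induction xs) auto
    finally show ?thesis by (simp add: marking_decode_def)
  qed
  ultimately show "recursive (\<lambda>e. count (marking_decode (e 0)) (e 1))" by simp
qed

lemma dec_marking_subset:
  assumes "recursive f" "recursive g"
  shows "dec (\<lambda>e. marking_decode (f e) \<subseteq># marking_decode (g e))"
proof (rule dec_comp2[OF _ assms])
  have "dec (\<lambda>e. \<forall>q<e 0. count (marking_decode (e 0)) q \<le> count (marking_decode (e 1)) q)"
    by (intro recursive_count rec_basic)
  moreover have "(\<forall>q<x. count (marking_decode x) q \<le> count (marking_decode y) q) \<longleftrightarrow>
      marking_decode x \<subseteq># marking_decode y" for x y
  proof -
    have "count (marking_decode x) q \<le> count (marking_decode y) q" if "\<not> q < x" for q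
      using that by (simp add: count_marking_decode_eq_0)
    then show ?thesis unfolding subseteq_mset_def by blast
  qed
  ultimately show "dec (\<lambda>e. marking_decode (e 0) \<subseteq># marking_decode (e 1))" by simp
qed

lemma dec_marking_eq:
  assumes "recursive f" "recursive g"
  shows "dec (\<lambda>e. marking_decode (f e) = marking_decode (g e))"
  using dec_conj[OF dec_marking_subset[OF assms] dec_marking_subset[OF assms(2,1)]]
  by (simp add: subset_mset.eq_iff)

lemmas rec_code = recursive_nthc recursive_count recursive_length recursive_fst_decode recursive_snd_decode
  recursive_min dec_mem_set_decode dec_ball_set dec_bex_set recursive_sum_set dec_marking_subset dec_marking_eq

lemma dec_comp3:
  assumes "dec (\<lambda>e. P (e 0) (e 1) (e 2))" "recursive f" "recursive g" "recursive h"
  shows "dec (\<lambda>e. P (f e) (g e) (h e))"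
proof -
  have "recursive (case_nat f (case_nat g (\<lambda>_. h)) i)" for i
    using assms by (auto split: nat.split)
  from dec_subst[OF assms(1), of "case_nat f (case_nat g (\<lambda>_. h))", OF this] show ?thesis
    by (simp add: numeral_2_eq_2)
qed

section \<open>Coded nets and problem instances\<close>

definition net_decode :: "nat \<Rightarrow> nat petri_net" where
  "net_decode y = \<lparr>places = set_decode (nthc y 0),
     transitions = (\<lambda>t. (marking_decode (fst (prod_decode t)), marking_decode (snd (prod_decode t)))) `
       set_decode (nthc y 1),
     initial = marking_decode (nthc y 2)\<rparr>"

text \<open>\<open>marking_decode\<close> accepts unsorted lists too; sortedness singles out the
  canonical codes, on which decoding can be inverted.\<close>

definition marking_code :: "nat \<Rightarrow> nat \<Rightarrow> bool" where
  "marking_code S x \<longleftrightarrow> sorted (list_decode x) \<and> set (list_decode x) \<subseteq> set_decode S"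

definition instance_code :: "nat \<Rightarrow> bool" where
  "instance_code x \<longleftrightarrow> length (list_decode x) = 3 \<and> length (list_decode (nthc x 0)) = 3 \<and>
     (\<forall>t\<in>set_decode (nthc (nthc x 0) 1). marking_code (nthc (nthc x 0) 0) (fst (prod_decode t)) \<and>
        marking_code (nthc (nthc x 0) 0) (snd (prod_decode t))) \<and>
     marking_code (nthc (nthc x 0) 0) (nthc (nthc x 0) 2) \<and>
     (\<forall>q\<in>set_decode (nthc x 1). q \<in> set_decode (nthc (nthc x 0) 0)) \<and>
     nthc x 2 \<in> set_decode (nthc (nthc x 0) 0)"

lemma marking_decode_encode [simp]: "marking_decode (marking_encode m) = m"
  by (simp add: marking_decode_def marking_encode_def)

lemma marking_encode_decode: "marking_code S x \<Longrightarrow> marking_encode (marking_decode x) = x"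
  by (simp add: marking_decode_def marking_encode_def marking_code_def sorted_sort_id)

lemma marking_code_encode:
  "set_mset m \<subseteq> set_decode S \<Longrightarrow> marking_code S (marking_encode m)"
  by (simp add: marking_code_def marking_encode_def)

lemma nthc_encode3:
  "nthc (list_encode [a, b, c]) 0 = a" "nthc (list_encode [a, b, c]) 1 = b"
  "nthc (list_encode [a, b, c]) 2 = c" "length (list_decode (list_encode [a, b, c])) = 3"
  using nthc_eq[of _ "list_encode [a, b, c]"] by (simp_all del: list_encode.simps One_nat_def)

lemma encode3_nthc:
  assumes "length (list_decode x) = 3" shows "list_encode [nthc x 0, nthc x 1, nthc x 2] = x"
proof -
  have "list_decode x = [nthc x 0, nthc x 1, nthc x 2]"
    using assms by (intro nth_equalityI) (auto simp: nthc_eq less_Suc_eq numeral_3_eq_3 numeral_2_eq_2)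
  then show ?thesis by (metis list_decode_inverse)
qed

lemma instance_encode_decode:
  assumes "petri_net N" "V \<subseteq> places N" "p \<in> places N"
  defines "x \<equiv> instance_encode N V p"
  shows "instance_code x" "net_decode (nthc x 0) = N" "set_decode (nthc x 1) = V" "nthc x 2 = p"
proof -
  have fin: "finite (places N)" "finite V" "finite (transitions N)"
    using assms(1,2) by (auto simp: petri_net_def intro: finite_subset)
  have x: "nthc x 0 = net_encode N" "nthc x 1 = set_encode V" "nthc x 2 = p" "length (list_decode x) = 3"
    by (simp_all add: x_def instance_encode_def nthc_encode3 del: list_encode.simps One_nat_def)
  have n: "nthc (net_encode N) 0 = set_encode (places N)"
    "nthc (net_encode N) 1 = set_encode (transition_encode ` transitions N)"
    "nthc (net_encode N) 2 = marking_encode (initial N)" "length (list_decode (net_encode N)) = 3"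
    by (simp_all add: net_encode_def nthc_encode3 del: list_encode.simps One_nat_def)
  show "net_decode (nthc x 0) = N"
    by (simp add: net_decode_def x(1) n fin set_encode_inverse image_image transition_encode_def del: One_nat_def)
  show "set_decode (nthc x 1) = V" "nthc x 2 = p" by (simp_all add: x fin del: One_nat_def)
  have P: "set_decode (set_encode (places N)) = places N" using fin by simp
  have "marking_code (set_encode (places N)) (fst (prod_decode t)) \<and>
      marking_code (set_encode (places N)) (snd (prod_decode t))"
    if "t \<in> transition_encode ` transitions N" for t
  proof -
    obtain a b where ab: "(a, b) \<in> transitions N" "t = transition_encode (a, b)" using \<open>t \<in> _\<close> by auto
    then have "set_mset a \<subseteq> places N" "set_mset b \<subseteq> places N"
      using assms(1) unfolding petri_net_def by blast+
    then show ?thesis by (simp add: ab(2) transition_encode_def marking_code_encode P)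
  qed
  moreover have "marking_code (set_encode (places N)) (marking_encode (initial N))"
    using assms(1) by (simp add: marking_code_encode P petri_net_def)
  ultimately show "instance_code x"
    using assms(2,3) unfolding instance_code_def x n P by (simp add: fin subset_iff)
qed

lemma instance_decode_encode:
  fixes x
  defines "N \<equiv> net_decode (nthc x 0)" and "V \<equiv> set_decode (nthc x 1)" and "p \<equiv> nthc x 2"
  assumes x: "instance_code x"
  shows "petri_net N" "V \<subseteq> places N" "p \<in> places N" "instance_encode N V p = x"
proof -
  have P: "places N = set_decode (nthc (nthc x 0) 0)" by (simp add: N_def net_decode_def)
  show "V \<subseteq> places N" "p \<in> places N" using x by (auto simp: P V_def p_def instance_code_def)
  show "petri_net N"
    using x by (auto simp: petri_net_def N_def net_decode_def instance_code_def marking_code_def marking_decode_def)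
  \<comment> \<open>Both markings of every coded transition are canonical, so re-encoding returns
    the very set of codes.\<close>
  have "transition_encode ` transitions N = (\<lambda>t. t) ` set_decode (nthc (nthc x 0) 1)"
    unfolding N_def net_decode_def petri_net.simps image_image
    using x by (intro image_cong) (auto simp: instance_code_def transition_encode_def marking_encode_decode)
  moreover have "marking_encode (initial N) = nthc (nthc x 0) 2"
    using x by (auto simp: instance_code_def N_def net_decode_def marking_encode_decode)
  ultimately have "net_encode N = nthc x 0"
    using encode3_nthc[of "nthc x 0"] x by (simp add: net_encode_def P instance_code_def del: list_encode.simps One_nat_def)
  then show "instance_encode N V p = x"
    using encode3_nthc[of x] x by (simp add: instance_encode_def V_def p_def instance_code_def del: list_encode.simps One_nat_def)
qed

lemma dec_marking_code:
  assumes "recursive f" "recursive g" shows "dec (\<lambda>e. marking_code (f e) (g e))"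
proof (rule dec_comp2[OF _ assms])
  have "dec (\<lambda>e. \<forall>i<length (list_decode (e 1)). nthc (e 1) i \<in> set_decode (e 0) \<and>
      (Suc i < length (list_decode (e 1)) \<longrightarrow> nthc (e 1) i \<le> nthc (e 1) (Suc i)))"
    by (intro rec_code rec_basic)
  moreover have "(\<forall>i<length (list_decode x). nthc x i \<in> set_decode S \<and>
      (Suc i < length (list_decode x) \<longrightarrow> nthc x i \<le> nthc x (Suc i))) \<longleftrightarrow> marking_code S x" for S x
    unfolding marking_code_def sorted_iff_nth_Suc by (auto simp: nthc_eq in_set_conv_nth subset_iff)
  ultimately show "dec (\<lambda>e. marking_code (e 0) (e 1))" by simp
qed

lemma dec_instance_code: "dec (\<lambda>e. instance_code (e 0))"
  unfolding instance_code_def by (intro dec_marking_code rec_code rec_basic)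

section \<open>Firings and loops on codes\<close>

definition fires_code :: "nat \<Rightarrow> nat \<Rightarrow> nat \<Rightarrow> bool" where
  "fires_code x a b \<longleftrightarrow> fires (net_decode (nthc x 0)) (marking_decode a) (marking_decode b)"

lemma dec_fires_code:
  assumes "recursive f" "recursive g" "recursive h" shows "dec (\<lambda>e. fires_code (f e) (g e) (h e))"
proof (rule dec_comp3[OF _ assms])
  let ?a = "\<lambda>t. fst (prod_decode t)" and ?b = "\<lambda>t. snd (prod_decode t)"
  let ?c = "\<lambda>y. count (marking_decode y)"
  \<comment> \<open>The successor equation is written without subtraction and checked place by
    place. The sum of the four codes bounds all places where one of the markings is nonzero.\<close>
  have "dec (\<lambda>e. \<exists>t\<in>set_decode (nthc (nthc (e 0) 0) 1). marking_decode (?a t) \<subseteq># marking_decode (e 1) \<and>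
      (\<forall>q<e 1 + (e 2 + (?a t + ?b t)). ?c (e 2) q + ?c (?a t) q = ?c (e 1) q + ?c (?b t) q))"
    by (intro rec_code rec_basic)
  moreover have "fires_code x y z \<longleftrightarrow> (\<exists>t\<in>set_decode (nthc (nthc x 0) 1). marking_decode (?a t) \<subseteq># marking_decode y \<and>
      (\<forall>q<y + (z + (?a t + ?b t)). ?c z q + ?c (?a t) q = ?c y q + ?c (?b t) q))" for x y z
  proof -
    have "marking_decode z = marking_decode y - marking_decode a + marking_decode b \<longleftrightarrow>
        (\<forall>q<y + (z + (a + b)). ?c z q + ?c a q = ?c y q + ?c b q)"
      if "marking_decode a \<subseteq># marking_decode y" for a b
    proof -
      have "(\<forall>q<y + (z + (a + b)). ?c z q + ?c a q = ?c y q + ?c b q) \<longleftrightarrow>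
          (\<forall>q. ?c z q + ?c a q = ?c y q + ?c b q)"
        by (metis (no_types, opaque_lifting) count_marking_decode_eq_0 not_less add_leD1 add_leD2)
      also have "\<dots> \<longleftrightarrow> marking_decode z + marking_decode a = marking_decode y + marking_decode b"
        by (simp add: multiset_eq_iff)
      also obtain d where d: "marking_decode y = marking_decode a + d"
        using \<open>marking_decode a \<subseteq># marking_decode y\<close> by (metis mset_subset_eq_exists_conv)
      then have "marking_decode z + marking_decode a = marking_decode y + marking_decode b \<longleftrightarrow>
          marking_decode z = marking_decode y - marking_decode a + marking_decode b"
        by (simp add: ac_simps)
      finally show ?thesis ..
    qed
    note eq = this
    have "fires_code x y z \<longleftrightarrow> (\<exists>t\<in>set_decode (nthc (nthc x 0) 1). marking_decode (?a t) \<subseteq># marking_decode y \<and>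
        marking_decode z = marking_decode y - marking_decode (?a t) + marking_decode (?b t))"
      unfolding fires_code_def fires_def net_decode_def by simp
    also have "\<dots> \<longleftrightarrow> (\<exists>t\<in>set_decode (nthc (nthc x 0) 1). marking_decode (?a t) \<subseteq># marking_decode y \<and>
      (\<forall>q<y + (z + (?a t + ?b t)). ?c z q + ?c (?a t) q = ?c y q + ?c (?b t) q))"
      by (intro bex_cong refl conj_cong eq)
    finally show ?thesis .
  qed
  ultimately show "dec (\<lambda>e. fires_code (e 0) (e 1) (e 2))" by simp
qed

text \<open>A path of markings is lifted step by step to codes; any code of the next marking will
  do, as the relation depends on decoded values only.\<close>

lemma rtranclp_surj:
  assumes "surj g"
  shows "R\<^sup>*\<^sup>* (g a) n \<longleftrightarrow> (\<exists>b. g b = n \<and> (\<lambda>x y. R (g x) (g y))\<^sup>*\<^sup>* a b)"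
proof
  assume "R\<^sup>*\<^sup>* (g a) n"
  then show "\<exists>b. g b = n \<and> (\<lambda>x y. R (g x) (g y))\<^sup>*\<^sup>* a b"
  proof induction
    case (step y z)
    then obtain b where "g b = y" "(\<lambda>x y. R (g x) (g y))\<^sup>*\<^sup>* a b" by blast
    moreover obtain c where "g c = z" using assms by (metis surjD)
    ultimately show ?case using step(2) by (intro exI[of _ c]) (auto intro: rtranclp.rtrancl_into_rtrancl)
  qed auto
next
  assume "\<exists>b. g b = n \<and> (\<lambda>x y. R (g x) (g y))\<^sup>*\<^sup>* a b"
  then obtain b where b: "g b = n" "(\<lambda>x y. R (g x) (g y))\<^sup>*\<^sup>* a b" by blast
  from b(2) have "R\<^sup>*\<^sup>* (g a) (g b)" by induction (auto intro: rtranclp.rtrancl_into_rtrancl)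
  with b(1) show "R\<^sup>*\<^sup>* (g a) n" by simp
qed

definition visits_code :: "nat \<Rightarrow> bool" where
  "visits_code x \<longleftrightarrow> infinitely_visits (net_decode (nthc x 0)) (set_decode (nthc x 1)) (nthc x 2)"

definition region_code :: "nat \<Rightarrow> nat \<Rightarrow> bool" where
  "region_code x a \<longleftrightarrow> region (set_decode (nthc x 1)) (nthc x 2) (count (marking_decode a))"

definition loop_code :: "nat \<Rightarrow> bool" where
  "loop_code x \<longleftrightarrow> (\<exists>a a1 b. (\<lambda>y z. fires_code x y z)\<^sup>*\<^sup>* (nthc (nthc x 0) 2) a \<and>
     (fires_code x a a1 \<and> region_code x a) \<and> (\<lambda>y z. fires_code x y z \<and> region_code x y)\<^sup>*\<^sup>* a1 b \<and>
     marking_decode a \<subseteq># marking_decode b)"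

lemma visits_code_iff_loop:
  assumes "instance_code x" shows "visits_code x \<longleftrightarrow> loop_code x"
proof -
  let ?N = "net_decode (nthc x 0)" and ?V = "set_decode (nthc x 1)" and ?p = "nthc x 2"
  interpret petri_instance ?N ?V ?p
    by unfold_locales (use instance_decode_encode[OF assms] in auto)
  have surj: "surj marking_decode" using marking_decode_surj by (metis surjI)
  have init: "initial ?N = marking_decode (nthc (nthc x 0) 2)" by (simp add: net_decode_def)
  have rf: "fires_code x y z \<and> region_code x y \<longleftrightarrow> rfires (marking_decode y) (marking_decode z)" for y z
    unfolding fires_code_def region_code_def rfires_def ..
  have "visits_code x \<longleftrightarrow> (\<exists>m m1 n. (fires ?N)\<^sup>*\<^sup>* (initial ?N) m \<and> rfires m m1 \<and> rfires\<^sup>*\<^sup>* m1 n \<and> m \<subseteq># n)"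
    unfolding visits_code_def by (rule infinitely_visits_iff_loop)
  also have "\<dots> \<longleftrightarrow> (\<exists>a m1 n. (\<lambda>y z. fires_code x y z)\<^sup>*\<^sup>* (nthc (nthc x 0) 2) a \<and>
      rfires (marking_decode a) m1 \<and> rfires\<^sup>*\<^sup>* m1 n \<and> marking_decode a \<subseteq># n)"
    unfolding init rtranclp_surj[OF surj] fires_code_def by blast
  also have "\<dots> \<longleftrightarrow> (\<exists>a a1 n. (\<lambda>y z. fires_code x y z)\<^sup>*\<^sup>* (nthc (nthc x 0) 2) a \<and>
      rfires (marking_decode a) (marking_decode a1) \<and> rfires\<^sup>*\<^sup>* (marking_decode a1) n \<and> marking_decode a \<subseteq># n)"
    using marking_decode_surj by metis
  also have "\<dots> \<longleftrightarrow> loop_code x"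
    unfolding loop_code_def rf rtranclp_surj[OF surj] by blast
  finally show ?thesis .
qed

lemma dec_region:
  assumes "recursive f" "recursive g" "recursive (\<lambda>e. h (e 0) (\<lambda>i. e (Suc i)))"
  shows "dec (\<lambda>e. region (set_decode (f e)) (g e) (\<lambda>q. h q e))"
proof -
  have "recursive (\<lambda>e. h (g e) e)" using recursive_app[OF assms(3,2)] .
  then show ?thesis unfolding region_def by (intro rec_code rec_basic assms)
qed

lemma dec_region_code:
  assumes "recursive f" "recursive g" shows "dec (\<lambda>e. region_code (f e) (g e))"
proof (rule dec_comp2[OF _ assms])
  show "dec (\<lambda>e. region_code (e 0) (e 1))"
    unfolding region_code_def by (intro dec_region rec_code rec_basic)
qed

lemma re_loop_code: "re (\<lambda>e. loop_code (e 0))"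
  unfolding loop_code_def
  by (intro re_ex re_conj re_rtranclp; (rule re_dec)?; intro dec_fires_code dec_region_code rec_code rec_basic)

section \<open>Certificates on codes\<close>

definition edge_src :: "nat \<Rightarrow> nat" where "edge_src e = fst (prod_decode e)"
definition edge_trans :: "nat \<Rightarrow> nat" where "edge_trans e = fst (prod_decode (snd (prod_decode e)))"
definition edge_tgt :: "nat \<Rightarrow> nat" where "edge_tgt e = snd (prod_decode (snd (prod_decode e)))"
definition trans_pre :: "nat \<Rightarrow> nat" where "trans_pre t = fst (prod_decode t)"
definition trans_post :: "nat \<Rightarrow> nat" where "trans_post t = snd (prod_decode t)"

lemmas edge_defs = edge_src_def edge_trans_def edge_tgt_def trans_pre_def trans_post_def

text \<open>The first two conditions of \<open>certificate\<close>. All quantifiers range over coded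
  finite sets, so this part is decidable.\<close>

definition closed_code :: "nat \<Rightarrow> nat \<Rightarrow> nat \<Rightarrow> nat \<Rightarrow> bool" where
  "closed_code y B W E \<longleftrightarrow>
     (\<exists>w\<in>set_decode W. \<forall>q\<in>set_decode (nthc y 0).
        nthc w q = min B (count (marking_decode (nthc y 2)) q)) \<and>
     (\<forall>w\<in>set_decode W. \<forall>t\<in>set_decode (nthc y 1).
        (\<forall>q\<in>set_decode (nthc y 0).
           count (marking_decode (trans_pre t)) q \<le> nthc w q \<or> B \<le> nthc w q) \<longrightarrow>
        (\<exists>e\<in>set_decode E. edge_src e = w \<and>
           marking_decode (trans_pre (edge_trans e)) = marking_decode (trans_pre t) \<and>
           marking_decode (trans_post (edge_trans e)) = marking_decode (trans_post t) \<and>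
           edge_tgt e \<in> set_decode W \<and>
           (\<forall>q\<in>set_decode (nthc y 0). nthc (edge_tgt e) q =
              (if B \<le> nthc w q then B else min B (nthc w q - count (marking_decode (trans_pre t)) q +
                 count (marking_decode (trans_post t)) q)))))"

definition splits_code :: "nat \<Rightarrow> bool" where
  "splits_code s \<longleftrightarrow> (\<exists>X. (\<exists>e\<in>set_decode s. edge_tgt e \<in> set_decode X) \<and>
     (\<exists>e\<in>set_decode s. \<not> edge_src e \<in> set_decode X) \<and>
     (\<forall>e\<in>set_decode s. edge_src e \<in> set_decode X \<longrightarrow> edge_tgt e \<in> set_decode X))"

definition ranked_code :: "nat \<Rightarrow> nat \<Rightarrow> bool" where
  "ranked_code S s \<longleftrightarrow> (\<exists>y h.
     (\<forall>e\<in>set_decode s.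
        (\<Sum>q\<in>set_decode S. nthc y q * count (marking_decode (trans_post (edge_trans e))) q) + nthc h (edge_src e) \<le>
        (\<Sum>q\<in>set_decode S. nthc y q * count (marking_decode (trans_pre (edge_trans e))) q) + nthc h (edge_tgt e)) \<and>
     (\<exists>e\<in>set_decode s.
        (\<Sum>q\<in>set_decode S. nthc y q * count (marking_decode (trans_post (edge_trans e))) q) + nthc h (edge_src e) <
        (\<Sum>q\<in>set_decode S. nthc y q * count (marking_decode (trans_pre (edge_trans e))) q) + nthc h (edge_tgt e)))"

text \<open>A subset has at most the code of the whole set, so \<open>s < Suc E\<close> captures all
  subsets, with 0 coding the empty one. Being bounded, this universal quantifier preserves
  semidecidability of the alternatives.\<close>

definition certificate_code :: "nat \<Rightarrow> bool" where
  "certificate_code x \<longleftrightarrow> (\<exists>B W E. (1 \<le> B \<and> closed_code (nthc x 0) B W E) \<and>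
     (\<forall>s<Suc E. (s = 0 \<or> \<not> (\<forall>e\<in>set_decode s. e \<in> set_decode E) \<or>
        (\<exists>e\<in>set_decode s. \<not> region (set_decode (nthc x 1)) (nthc x 2) (nthc (edge_src e)))) \<or>
        splits_code s \<or> ranked_code (nthc (nthc x 0) 0) s))"

lemma re_splits_code: "re (\<lambda>e. splits_code (e 0))"
  unfolding splits_code_def edge_defs by (intro re_ex re_dec rec_code rec_basic)

lemma re_ranked_code: "re (\<lambda>e. ranked_code (e 0) (e 1))"
  unfolding ranked_code_def edge_defs by (intro re_ex re_dec rec_code rec_basic)

lemma dec_closed_code: "dec (\<lambda>e. closed_code (e 0) (e 1) (e 2) (e 3))"
  unfolding closed_code_def edge_defs by (intro rec_code rec_basic)

lemma re_certificate_code: "re (\<lambda>e. certificate_code (e 0))"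
proof -
  \<comment> \<open>Under the quantifiers for \<open>B\<close>, \<open>W\<close> and
    \<open>E\<close> these are entries 2, 1 and 0, and the instance is entry 3.\<close>
  let ?c = "case_nat (\<lambda>e. nthc (e 3) 0) (case_nat (\<lambda>e. e 2) (case_nat (\<lambda>e. e 1) (\<lambda>_ e :: nat \<Rightarrow> nat. e 0)))"
  have "recursive (?c i)" for i
    by (auto split: nat.split intro!: recursive_nthc rec_basic)
  from dec_subst[OF dec_closed_code, of ?c, OF this]
  have c: "dec (\<lambda>e. closed_code (nthc (e 3) 0) (e 2) (e 1) (e 0))"
    by (simp add: numeral_2_eq_2 numeral_3_eq_3)
  \<comment> \<open>The bounded variable \<open>s\<close> now occupies entry 0 and shifts the
    instance to entry 4.\<close>
  let ?r = "case_nat (\<lambda>e. nthc (nthc (e 4) 0) 0) (\<lambda>_ e :: nat \<Rightarrow> nat. e 0)"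
  have "recursive (?r i)" for i
    by (auto split: nat.split intro!: recursive_nthc rec_basic)
  from re_subst[OF re_ranked_code, of ?r, OF this]
  have r: "re (\<lambda>e. ranked_code (nthc (nthc (e 4) 0) 0) (e 0))" by simp
  show ?thesis
    unfolding certificate_code_def edge_defs
    apply (intro re_ex re_conj re_ball re_disj)
    subgoal by (intro re_dec rec_basic)
    subgoal by (rule re_dec) (use c in \<open>simp add: numeral_2_eq_2 numeral_3_eq_3\<close>)
    subgoal by (intro re_dec dec_region rec_code rec_basic)
    subgoal by (intro re_dec dec_region rec_code rec_basic)
    subgoal by (intro re_dec dec_region rec_code rec_basic)
    subgoal by (rule re_splits_code)
    subgoal using r by (simp add: eval_nat_numeral)
    subgoal by (intro rec_basic)
    done
qed

text \<open>An arbitrary splitting set still splits after intersecting it with the targets of the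
  edges; the intersection is finite and has a code.\<close>

lemma splits_code_iff: "splits_code s \<longleftrightarrow> splits edge_src edge_tgt (set_decode s)"
proof
  assume "splits edge_src edge_tgt (set_decode s)"
  then obtain X where X: "\<exists>e\<in>set_decode s. edge_tgt e \<in> X" "\<exists>e\<in>set_decode s. edge_src e \<notin> X"
    "\<forall>e\<in>set_decode s. edge_src e \<in> X \<longrightarrow> edge_tgt e \<in> X" unfolding splits_def by blast
  define Y where "Y = X \<inter> edge_tgt ` set_decode s"
  have "finite Y" by (simp add: Y_def)
  then show "splits_code s"
    unfolding splits_code_def using X by (intro exI[of _ "set_encode Y"]) (auto simp: Y_def)
qed (auto simp: splits_code_def splits_def)

lemma visits_code_iff_certificate:
  assumes x: "instance_code x" shows "\<not> visits_code x \<longleftrightarrow> certificate_code x"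
proof -
  let ?N = "net_decode (nthc x 0)" and ?V = "set_decode (nthc x 1)" and ?p = "nthc x 2"
  let ?S = "set_decode (nthc (nthc x 0) 0)"
  have sel: "places ?N = ?S" "initial ?N = marking_decode (nthc (nthc x 0) 2)"
    "transitions ?N = (\<lambda>t. (marking_decode (trans_pre t), marking_decode (trans_post t))) ` set_decode (nthc (nthc x 0) 1)"
    by (simp_all add: net_decode_def edge_defs)
  \<comment> \<open>Numbers themselves serve as nodes and edges: a node \<open>w\<close> carries the
    valuation \<open>nthc w\<close>.\<close>
  interpret abstraction ?N ?V ?p edge_src edge_tgt
    "\<lambda>e. marking_decode (trans_pre (edge_trans e))" "\<lambda>e. marking_decode (trans_post (edge_trans e))" nthc
    by unfold_locales (use instance_decode_encode[OF x] in auto)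
  have ranked: "ranked_code (nthc (nthc x 0) 0) s \<longleftrightarrow> ranked (set_decode s)" for s
  proof
    assume "ranked (set_decode s)"
    then obtain y h where yh:
      "\<forall>e\<in>set_decode s. (\<Sum>q\<in>?S. y q * count (marking_decode (trans_post (edge_trans e))) q) + h (edge_src e) \<le>
        (\<Sum>q\<in>?S. y q * count (marking_decode (trans_pre (edge_trans e))) q) + h (edge_tgt e)"
      "\<exists>e\<in>set_decode s. (\<Sum>q\<in>?S. y q * count (marking_decode (trans_post (edge_trans e))) q) + h (edge_src e) <
        (\<Sum>q\<in>?S. y q * count (marking_decode (trans_pre (edge_trans e))) q) + h (edge_tgt e)"
      unfolding ranked_def sel by blast
    \<comment> \<open>Weights matter only on the places and the potential only at the ends of edges,
      so both have codes.\<close>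
    obtain cy where cy: "\<forall>q\<in>?S. nthc cy q = y q" using ex_nthc[of ?S] by auto
    obtain ch where ch: "\<forall>v\<in>edge_src ` set_decode s \<union> edge_tgt ` set_decode s. nthc ch v = h v"
      using ex_nthc[of "edge_src ` set_decode s \<union> edge_tgt ` set_decode s"] by auto
    show "ranked_code (nthc (nthc x 0) 0) s"
      unfolding ranked_code_def
      by (rule exI[of _ cy], rule exI[of _ ch]) (use yh cy ch in simp)
  next
    assume "ranked_code (nthc (nthc x 0) 0) s"
    then show "ranked (set_decode s)" unfolding ranked_code_def ranked_def sel by blast
  qed
  have closed: "closed_code (nthc x 0) B W E \<longleftrightarrow>
     (\<exists>w\<in>set_decode W. \<forall>q\<in>places ?N. nthc w q = min B (count (initial ?N) q)) \<and>
     (\<forall>w\<in>set_decode W. \<forall>(a, b)\<in>transitions ?N. enabled B (nthc w) a \<longrightarrow>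
        (\<exists>e\<in>set_decode E. edge_src e = w \<and> marking_decode (trans_pre (edge_trans e)) = a \<and>
          marking_decode (trans_post (edge_trans e)) = b \<and> edge_tgt e \<in> set_decode W \<and>
          succ B (nthc w) a b (nthc (edge_tgt e))))" for B W E
    unfolding closed_code_def enabled_def succ_def sel by simp
  have sub: "(\<forall>F\<subseteq>set_decode E. F \<noteq> {} \<longrightarrow> P F) \<longleftrightarrow>
      (\<forall>s<Suc E. (s = 0 \<or> \<not> (\<forall>e\<in>set_decode s. e \<in> set_decode E)) \<or> P (set_decode s))" for E P
  proof
    assume *: "\<forall>s<Suc E. (s = 0 \<or> \<not> (\<forall>e\<in>set_decode s. e \<in> set_decode E)) \<or> P (set_decode s)"
    show "\<forall>F\<subseteq>set_decode E. F \<noteq> {} \<longrightarrow> P F"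
    proof (intro allI impI)
      fix F assume F: "F \<subseteq> set_decode E" "F \<noteq> {}"
      then have fin: "finite F" using finite_set_decode finite_subset by blast
      \<comment> \<open>A set code is a sum of powers of two, so it grows with the set.\<close>
      have "set_encode F \<le> set_encode (set_decode E)"
        unfolding set_encode_def by (rule sum_mono2) (use F in auto)
      then have "set_encode F < Suc E" by simp
      moreover have "set_encode F \<noteq> 0" using F(2) fin by (metis set_decode_zero set_encode_inverse)
      ultimately show "P F" using *[rule_format, of "set_encode F"] F(1) fin by auto
    qed
  next
    assume *: "\<forall>F\<subseteq>set_decode E. F \<noteq> {} \<longrightarrow> P F"
    have "set_decode s \<noteq> {}" if "s \<noteq> 0" for s
      using that by (metis set_decode_inverse set_encode_empty)
    then show "\<forall>s<Suc E. (s = 0 \<or> \<not> (\<forall>e\<in>set_decode s. e \<in> set_decode E)) \<or> P (set_decode s)"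
      using * by blast
  qed
  have cert: "certificate_code x \<longleftrightarrow> (\<exists>B W E. 1 \<le> B \<and> certificate B (set_decode W) (set_decode E))"
    unfolding certificate_code_def certificate_def closed ranked splits_code_iff sub
    by (simp only: conj_assoc disj_assoc)
  show ?thesis
  proof
    assume "\<not> visits_code x"
    then have not: "\<not> infinitely_visits ?N ?V ?p" by (simp add: visits_code_def)
    have val: "\<exists>w. \<forall>q\<in>places ?N. nthc w q = v q" for v
      using ex_nthc[of ?S v] by (simp add: sel)
    have edge: "\<exists>e. edge_src e = w \<and> marking_decode (trans_pre (edge_trans e)) = a \<and>
        marking_decode (trans_post (edge_trans e)) = b \<and> edge_tgt e = w'"
      if "(a, b) \<in> transitions ?N" for w a b w'
    proof -
      obtain t where "a = marking_decode (trans_pre t)" "b = marking_decode (trans_post t)"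
        using \<open>(a, b) \<in> transitions ?N\<close> unfolding sel by blast
      then show ?thesis
        by (intro exI[of _ "prod_encode (w, prod_encode (t, w'))"]) (simp add: edge_src_def edge_trans_def edge_tgt_def)
    qed
    obtain B W E where "1 \<le> B" "finite W" "finite E" "certificate B W E"
      using certificate_complete[OF not val edge] by blast
    then show "certificate_code x"
      unfolding cert by (intro exI[of _ B] exI[of _ "set_encode W"] exI[of _ "set_encode E"]) simp
  next
    assume "certificate_code x"
    then obtain B W E where "1 \<le> B" "certificate B (set_decode W) (set_decode E)" unfolding cert by blast
    then show "\<not> visits_code x"
      unfolding visits_code_def by (intro certificate_sound) simp_all
  qed
qed

section \<open>Decidability from both semidecision procedures\<close>

theorem theorem5p13:
  shows "decidable_set
    {instance_encode N V p | (N :: nat petri_net) (V :: nat set) (p :: nat).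
       petri_net N \<and> V \<subseteq> places N \<and> p \<in> places N \<and> infinitely_visits N V p}"
    (is "decidable_set ?A")
proof -
  have A: "x \<in> ?A \<longleftrightarrow> instance_code x \<and> visits_code x" for x
  proof
    assume "x \<in> ?A"
    then obtain N V p where "x = instance_encode N V p" "petri_net N" "V \<subseteq> places N" "p \<in> places N"
      "infinitely_visits N V p" by blast
    then show "instance_code x \<and> visits_code x"
      using instance_encode_decode[of N V p] unfolding visits_code_def by metis
  next
    assume "instance_code x \<and> visits_code x"
    then show "x \<in> ?A" using instance_decode_encode[of x] unfolding visits_code_def
      by (intro CollectI exI[of _ "net_decode (nthc x 0)"] exI[of _ "set_decode (nthc x 1)"] exI[of _ "nthc x 2"])
        simp
  qed
  have pos: "x \<in> ?A \<longleftrightarrow> instance_code x \<and> loop_code x" for x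
    unfolding A using visits_code_iff_loop by blast
  \<comment> \<open>Numbers that code no instance lie in the complement as well and are recognised
    by the first disjunct.\<close>
  have neg: "x \<notin> ?A \<longleftrightarrow> \<not> instance_code x \<or> certificate_code x" for x
    unfolding A using visits_code_iff_certificate by blast
  show ?thesis
  proof (rule decidable_set_dec, rule dec_re_compl)
    show "re (\<lambda>e. e 0 \<in> ?A)" unfolding pos
      by (rule re_conj[OF re_dec[OF dec_instance_code] re_loop_code])
    show "re (\<lambda>e. e 0 \<notin> ?A)" unfolding neg
      by (rule re_disj[OF re_dec[OF dec_not[OF dec_instance_code]] re_certificate_code])
  qed
qed

end
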